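(* Let $I=[x,x+y]\subset[0,\infty)$ with $y>0$, and let $l,k\in\mathbb{N}$ be coprime. Then for every non-negative $f\in W^{1,1}(I)$ with $\rho_I(f)>k$, \[ \sum_{\substack{p\in I\\ p\equiv l \bmod k}} f(p) < \frac{2\,\|f\|_{1,I}}{\varphi(k)\log(\rho_I(f)/k)}\left( 1+ \frac{8}{\log (\rho_I(f)/k)} \right) \] and \[ \sum_{\substack{p\in I\\ p\equiv l \bmod k}} f(p) < \frac{3\,\|f\|_{1,I}}{\varphi(k)\log (\rho_I(f)/k)}, \] where the sums run over primes $p$.
   Context: $W^{1,1}(I)$ denotes the closure of $C^1(I)$ with respect to the norm $\|f\|_{1,I}+\|f'\|_{1,I}$, where $\|g\|_{1,I}=\int_I|g(t)|\,dt$; it is regarded as a subspace of $C^0(I)$. $\|f\|_{\infty,I}=\sup_{t\in I}|f(t)|$. The functional $\rho_I\colon W^{1,1}(I)\to[0,\infty)$ is defined by $\rho_I(f)=\|f\|_{1,I}/(\|f\|_{\infty,I}+\|f'\|_{1,I})$ for $f\neq 0$ and $\rho_I(0)=0$. $\varphi$ is Euler's totient function. *)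

theory Defs
  imports "HOL-Analysis.Analysis" "HOL-Number_Theory.Number_Theory"
begin

definition C1_with_deriv :: "real set \<Rightarrow> (real \<Rightarrow> real) \<Rightarrow> (real \<Rightarrow> real) \<Rightarrow> bool" where
  "C1_with_deriv I u u' \<longleftrightarrow> continuous_on I u' \<and>
     (\<forall>t\<in>I. (u has_real_derivative u' t) (at t within I))"

text \<open>g is the (weak) derivative of f in the sense of W^{1,1}(I): f is the limit of C^1
  functions u n in the norm ||.||_1 + ||(.)'||_1, with derivatives converging to g in L^1.\<close>
definition W11_deriv :: "real set \<Rightarrow> (real \<Rightarrow> real) \<Rightarrow> (real \<Rightarrow> real) \<Rightarrow> bool" where
  "W11_deriv I f g \<longleftrightarrow> g absolutely_integrable_on I \<and>
     (\<exists>u u' :: nat \<Rightarrow> real \<Rightarrow> real. (\<forall>n. C1_with_deriv I (u n) (u' n)) \<and>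
        ((\<lambda>n. integral I (\<lambda>t. \<bar>u n t - f t\<bar>) + integral I (\<lambda>t. \<bar>u' n t - g t\<bar>))
           \<longlongrightarrow> 0) sequentially)"

text \<open>W^{1,1}(I), regarded as a subspace of C^0(I).\<close>
definition W11 :: "real set \<Rightarrow> (real \<Rightarrow> real) \<Rightarrow> bool" where
  "W11 I f \<longleftrightarrow> continuous_on I f \<and> (\<exists>g. W11_deriv I f g)"

definition norm1 :: "real set \<Rightarrow> (real \<Rightarrow> real) \<Rightarrow> real" where
  "norm1 I f = integral I (\<lambda>t. \<bar>f t\<bar>)"

definition norm_inf :: "real set \<Rightarrow> (real \<Rightarrow> real) \<Rightarrow> real" where
  "norm_inf I f = (SUP t\<in>I. \<bar>f t\<bar>)"

text \<open>||f'||_1 (independent of the choice of weak derivative, which is unique a.e.).\<close>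
definition deriv_norm1 :: "real set \<Rightarrow> (real \<Rightarrow> real) \<Rightarrow> real" where
  "deriv_norm1 I f = norm1 I (SOME g. W11_deriv I f g)"

definition rho :: "real set \<Rightarrow> (real \<Rightarrow> real) \<Rightarrow> real" where
  "rho I f = (if (\<forall>t\<in>I. f t = 0) then 0
              else norm1 I f / (norm_inf I f + deriv_norm1 I f))"

end

theory Submission
  imports Defs "HOL-Computational_Algebra.Squarefree"
begin

text \<open>
  Summing over a residue class modulo \<open>q\<close> in \<open>I\<close>, the weights \<open>f\<close> give
  \<open>norm1 I f / q\<close> up to an error \<open>M = norm_inf I f + deriv_norm1 I f\<close>, so Selberg's sieve applies to
  the weights \<open>f\<close> directly, and \<open>X = rho I f / k\<close> plays the role of the ratio of interval length to
  modulus. With Selberg's optimal weights of level \<open>N\<close> the main term is at most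
  \<open>norm1 I f / (totient k * H)\<close>, where \<open>H\<close>, the sum of \<open>1 / totient m\<close> over squarefree \<open>m \<le> N\<close>, is at
  least \<open>harm N\<close>, and the error is at most \<open>M\<close> times the square of the sum of the absolute weights.
  Bounding each weight by 1 suffices for \<open>ln X \<le> 16\<close>, where the second inequality is the stronger one.
  For \<open>ln X \<ge> 16\<close> the saving of a logarithm in the sum of the absolute weights, from a
  Chebyshev bound, gives the first inequality.
\<close>

section \<open>The Selberg sum\<close>

text \<open>The density error is \<open>M\<close> for every modulus, so each pair of weights
  contributes at most \<open>M\<close> times the product of their absolute values. Primes up to
  \<open>N\<close> escape the weights and are counted with \<open>M\<close> each; this is the term
  \<open>real N\<close> beside the square. Uniformity in \<open>k\<close> rests on
  \<open>totient k * sieve_mass 1 N <= k * sieve_mass k N\<close>.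

  Put \<open>L = ln X\<close>. Beyond \<open>2 / L\<close> the first inequality allows only
  \<open>16 / L^2\<close>. A level \<open>N = exp ((L - c) / 2)\<close> with constant
  \<open>c\<close> gives a main term within order \<open>1 / L^2\<close> of \<open>2 / L\<close>,
  but with weights bounded by 1 the error \<open>N^2 / X\<close> has the constant size
  \<open>exp (- c)\<close>. Shrinking \<open>N\<close> by a factor \<open>L\<close> would turn the
  main term into about \<open>2 / (L - 2 * ln L)\<close>, with an excess of order
  \<open>ln L / L^2\<close>, too large for big \<open>L\<close>. The saved logarithm instead brings
  the error itself down to order \<open>1 / L^2\<close>. The threshold 16 is the value of
  \<open>L\<close> at which the two bounds agree.\<close>

definition sieve_support :: "nat \<Rightarrow> nat \<Rightarrow> nat set" where
  "sieve_support k N = {d. squarefree d \<and> coprime d k \<and> d \<le> N}"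

definition sieve_mass :: "nat \<Rightarrow> nat \<Rightarrow> real" where
  "sieve_mass k N = (\<Sum>m\<in>sieve_support k N. 1 / real (totient m))"

definition sieve_mass_dvd :: "nat \<Rightarrow> nat \<Rightarrow> nat \<Rightarrow> real" where
  "sieve_mass_dvd k N d = (\<Sum>m\<in>{m \<in> sieve_support k N. d dvd m}. 1 / real (totient m))"

section \<open>Squarefree numbers, their divisors and the sieve support\<close>

lemma squarefree_nat_pos: "squarefree (n::nat) \<Longrightarrow> n > 0"
  by (cases n) auto

lemma not_coprime_imp_prime:
  fixes a b :: nat
  assumes "\<not> coprime a b"
  shows "\<exists>p. prime p \<and> p dvd a \<and> p dvd b"
proof -
  from assms have "gcd a b \<noteq> 1" using coprime_iff_gcd_eq_1 by blast
  then obtain p where "prime p" "p dvd gcd a b" using prime_factor_nat by blast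
  then show ?thesis by auto
qed

lemma dvd_div_pos: "d dvd m \<Longrightarrow> m > 0 \<Longrightarrow> m div d > (0::nat)"
  by (cases "m div d") (auto simp: dvd_div_eq_0_iff)

lemma div_dvd_self: "d dvd m \<Longrightarrow> m div d dvd (m::nat)"
  by (metis dvd_div_mult_self dvd_triv_left)

lemma squarefree_coprime_div:
  fixes m d :: nat
  assumes "squarefree m" "d dvd m"
  shows "coprime d (m div d)"
proof (rule ccontr)
  assume "\<not> coprime d (m div d)"
  then obtain p where p: "prime p" "p dvd d" "p dvd m div d"
    using not_coprime_imp_prime by blast
  then have "p * p dvd d * (m div d)" by (rule_tac mult_dvd_mono)
  then have "p ^ 2 dvd m" using assms(2) by (simp add: power2_eq_square)
  with assms(1) have "p dvd 1" by (rule squarefreeD)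
  with p(1) show False by auto
qed

lemma totient_dvd_mult:
  fixes m d :: nat
  assumes "squarefree m" "d dvd m"
  shows "totient m = totient d * totient (m div d)"
  using totient_mult_coprime[OF squarefree_coprime_div[OF assms]] assms(2) by simp

lemma finite_sieve_support [simp]: "finite (sieve_support k N)"
  by (rule finite_subset[of _ "{..N}"]) (auto simp: sieve_support_def)

lemma sieve_support_pos: "m \<in> sieve_support k N \<Longrightarrow> m > 0"
  by (auto simp: sieve_support_def squarefree_nat_pos)

lemma sieve_support_dvd:
  assumes "m \<in> sieve_support k N" "d dvd m"
  shows "d \<in> sieve_support k N"
  using assms dvd_imp_le[OF assms(2) sieve_support_pos[OF assms(1)]]
    squarefree_mono[OF assms(2)] coprime_divisors[OF assms(2) dvd_refl, of k]
  by (auto simp: sieve_support_def)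

lemma one_in_sieve_support: "N \<ge> 1 \<Longrightarrow> 1 \<in> sieve_support k N"
  by (auto simp: sieve_support_def)

lemma sieve_mass_pos: "N \<ge> 1 \<Longrightarrow> sieve_mass k N > 0"
  unfolding sieve_mass_def
  using one_in_sieve_support[of N k]
  by (intro sum_pos) (auto dest: sieve_support_pos)

lemma sieve_mass_dvd_nonneg: "sieve_mass_dvd k N d \<ge> 0"
  unfolding sieve_mass_dvd_def by (intro sum_nonneg) auto

lemma sum_totient_div:
  assumes "n > 0"
  shows "(\<Sum>d | d dvd n. totient (n div d)) = (n::nat)"
proof -
  have "(\<Sum>d | d dvd n. totient (n div d)) = (\<Sum>d | d dvd n. totient d)"
    by (rule sum.reindex_bij_witness[of _ "\<lambda>d. n div d" "\<lambda>d. n div d"])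
      (use assms div_dvd_self in \<open>auto simp: div_div_eq_right\<close>)
  then show ?thesis by (simp add: totient_divisor_sum)
qed

text \<open>Gauss's identity writes \<open>d\<close> as the sum of \<open>totient (d div e)\<close>
  over \<open>e dvd d\<close>, and
  \<open>totient (d div e) / totient m = 1 / totient ((m div d) * e)\<close>. The map from
  \<open>(m, e)\<close> to \<open>(m div d) * e\<close> lands in the support, its value being a
  divisor of \<open>m\<close>, and is injective, since \<open>e\<close> is the gcd of the value with
  \<open>d\<close>. The result yields both \<open>abs_selberg_weight_le_1\<close> and the factor
  \<open>1 / d^2\<close> in \<open>sum_divisor_ratio_over_id_le\<close>.\<close>

lemma sieve_mass_dvd_le:
  assumes d: "d \<in> sieve_support k N"
  shows "real d * sieve_mass_dvd k N d \<le> sieve_mass k N"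
proof -
  define A where "A = {m \<in> sieve_support k N. d dvd m} \<times> {e. e dvd d}"
  define \<phi> where "\<phi> = (\<lambda>(m, e). (m div d) * (e::nat))"
  have d0: "d > 0" using sieve_support_pos[OF d] .
  have inj: "inj_on \<phi> A"
  proof (rule inj_onI)
    have gcd: "gcd (\<phi> (m, e)) d = e" if "(m, e) \<in> A" for m e
    proof -
      from that have "squarefree m" "d dvd m" "e dvd d"
        by (auto simp: A_def sieve_support_def)
      then have "coprime (m div d) d" using squarefree_coprime_div coprime_commute by blast
      then have "gcd ((m div d) * e) d = gcd e d"
        by (simp add: gcd_mult_left_left_cancel coprime_commute)
      then show ?thesis using \<open>e dvd d\<close> by (simp add: \<phi>_def gcd_nat.absorb1)
    qed
    fix u v assume uv: "u \<in> A" "v \<in> A" "\<phi> u = \<phi> v"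
    obtain m e m' e' where [simp]: "u = (m, e)" "v = (m', e')" by (cases u, cases v)
    have "e = e'" using gcd[of m e] gcd[of m' e'] uv by simp
    moreover have "e > 0" using uv d0 by (auto simp: A_def intro: Nat.gr0I)
    ultimately have "m div d = m' div d" using uv(3) by (simp add: \<phi>_def)
    moreover have "d dvd m" "d dvd m'" using uv by (auto simp: A_def)
    ultimately have "m = m'" by (metis dvd_div_mult_self)
    with \<open>e = e'\<close> show "u = v" by simp
  qed
  have sub: "\<phi> ` A \<subseteq> sieve_support k N"
  proof safe
    fix m e assume "(m, e) \<in> A"
    then have m: "m \<in> sieve_support k N" "d dvd m" "e dvd d" by (auto simp: A_def)
    have "(m div d) * e dvd (m div d) * d" using m(3) by (intro mult_dvd_mono) auto
    then have "\<phi> (m, e) dvd m" using m(2) by (simp add: \<phi>_def)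
    then show "\<phi> (m, e) \<in> sieve_support k N" using m(1) sieve_support_dvd by blast
  qed
  have tot: "1 / real (totient (\<phi> (m, e))) = real (totient (d div e)) / real (totient m)"
    if "(m, e) \<in> A" for m e
  proof -
    from that have m: "m \<in> sieve_support k N" "squarefree m" "d dvd m" "e dvd d"
      by (auto simp: A_def sieve_support_def)
    then have sd: "squarefree d" using squarefree_mono by blast
    have e0: "e > 0" using m d0 by (auto intro: Nat.gr0I)
    have "coprime (m div d) d" using squarefree_coprime_div m coprime_commute by blast
    then have "coprime (m div d) e" by (rule coprime_divisors[OF dvd_refl m(4)])
    then have 1: "totient (\<phi> (m, e)) = totient (m div d) * totient e"
      by (simp add: \<phi>_def totient_mult_coprime)
    have 2: "totient m = totient d * totient (m div d)" using totient_dvd_mult m by blast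
    have 3: "totient d = totient e * totient (d div e)" using totient_dvd_mult m sd by blast
    have "d div e > 0" using m d0 dvd_div_pos by blast
    then show ?thesis using 1 2 3 e0 sieve_support_pos[OF m(1)]
      by (auto simp: field_simps)
  qed
  have "real d * sieve_mass_dvd k N d
      = (\<Sum>m\<in>{m \<in> sieve_support k N. d dvd m}. \<Sum>e | e dvd d. real (totient (d div e)) / real (totient m))"
  proof -
    have "real d = (\<Sum>e | e dvd d. real (totient (d div e)))"
      using sum_totient_div[OF d0] by (metis of_nat_sum)
    then show ?thesis unfolding sieve_mass_dvd_def
      by (simp add: sum_distrib_left sum_divide_distrib)
  qed
  also have "\<dots> = (\<Sum>u\<in>A. 1 / real (totient (\<phi> u)))"
    unfolding A_def sum.cartesian_product
    by (intro sum.cong refl) (use tot in \<open>auto simp: A_def\<close>)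
  also have "\<dots> = (\<Sum>n\<in>\<phi> ` A. 1 / real (totient n))"
    by (subst sum.reindex[OF inj]) (simp add: o_def)
  also have "\<dots> \<le> sieve_mass k N"
    unfolding sieve_mass_def by (intro sum_mono2 sub) auto
  finally show ?thesis .
qed

text \<open>A squarefree \<open>m\<close> splits into its common part with \<open>k\<close> and a
  cofactor coprime to \<open>k\<close>. The sum of \<open>1 / totient e\<close> over the possible
  common parts \<open>e\<close> is \<open>k / totient k\<close>, which exchanges \<open>k\<close>
  for \<open>totient k\<close> in the main term.\<close>

lemma sieve_mass_1_le:
  assumes "k \<ge> 1"
  shows "sieve_mass 1 N \<le> real k / real (totient k) * sieve_mass k N"
proof -
  \<comment> \<open>The radical of \<open>k\<close>: its divisors are the possible common parts, and
    \<open>K / totient K = k / totient k\<close>.\<close>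
  define K where "K = \<Prod>(prime_factors k)"
  have K0: "K > 0" unfolding K_def by (intro prod_pos) (auto dest: in_prime_factors_imp_prime prime_gt_0_nat)
  have pfK: "prime_factors K = prime_factors k"
    unfolding K_def by (subst prime_factors_prod) (auto simp: prime_factorization_prime in_prime_factors_imp_prime)
  have sqK: "squarefree K" unfolding K_def
    by (intro squarefree_prod_coprime) (auto intro: primes_coprime squarefree_prime)
  have ratio: "real K / real (totient K) = real k / real (totient k)"
    using totient_formula2[of K] totient_formula2[of k] K0 assms by (simp add: pfK)
  define \<phi> where "\<phi> = (\<lambda>m. (gcd m K, m div gcd m K))"
  define B where "B = {e. e dvd K} \<times> sieve_support k N"
  have sub: "\<phi> ` sieve_support 1 N \<subseteq> B"
  proof (rule image_subsetI)
    fix m assume "m \<in> sieve_support 1 N"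
    then have m: "squarefree m" "m \<le> N" by (auto simp: sieve_support_def)
    let ?g = "gcd m K"
    have "coprime (m div ?g) k"
    proof (rule ccontr)
      assume "\<not> ?thesis"
      then obtain p where p: "prime p" "p dvd m div ?g" "p dvd k"
        using not_coprime_imp_prime by blast
      have "p \<in> prime_factors k" using p assms by (auto simp: in_prime_factors_iff)
      then have "p dvd K" unfolding pfK[symmetric] by auto
      moreover have "p dvd m" using p(2) dvd_trans div_dvd_self gcd_dvd1 by blast
      ultimately have "p dvd ?g" by simp
      then have "\<not> coprime ?g (m div ?g)" using p not_coprimeI not_prime_unit by blast
      then show False using squarefree_coprime_div[OF m(1), of ?g] by simp
    qed
    moreover have "squarefree (m div ?g)" using m(1)
      squarefree_mono div_dvd_self gcd_dvd1 by blast
    moreover have "m div ?g \<le> N" using m(2) div_le_dividend order_trans by blast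
    ultimately show "\<phi> m \<in> B" by (auto simp: \<phi>_def B_def sieve_support_def)
  qed
  have inj: "inj_on \<phi> (sieve_support 1 N)"
    by (rule inj_onI) (auto simp: \<phi>_def, metis dvd_div_mult_self gcd_dvd1)
  have tot: "1 / real (totient m) = (case \<phi> m of (e, n) \<Rightarrow> 1 / real (totient e) * (1 / real (totient n)))"
    if "m \<in> sieve_support 1 N" for m
    using totient_dvd_mult[of m "gcd m K"] that by (auto simp: \<phi>_def sieve_support_def)
  have "sieve_mass 1 N = (\<Sum>m\<in>sieve_support 1 N. (case \<phi> m of (e, n) \<Rightarrow> 1 / real (totient e) * (1 / real (totient n))))"
    unfolding sieve_mass_def using tot by (intro sum.cong) auto
  also have "\<dots> = (\<Sum>(e, n)\<in>\<phi> ` sieve_support 1 N. 1 / real (totient e) * (1 / real (totient n)))"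
    by (subst sum.reindex[OF inj]) (simp add: o_def)
  also have "\<dots> \<le> (\<Sum>(e, n)\<in>B. 1 / real (totient e) * (1 / real (totient n)))"
    by (intro sum_mono2 sub) (use K0 in \<open>auto simp: B_def\<close>)
  also have "\<dots> = (\<Sum>e | e dvd K. 1 / real (totient e)) * sieve_mass k N"
    unfolding B_def sum.cartesian_product[symmetric] sieve_mass_def by (simp add: sum_product)
  also have "(\<Sum>e | e dvd K. 1 / real (totient e)) = (\<Sum>e | e dvd K. real (totient (K div e)) / real (totient K))"
  proof (rule sum.cong)
    fix e assume "e \<in> {e. e dvd K}"
    then have e: "e dvd K" by simp
    then have "K div e > 0" using K0 e dvd_div_pos by blast
    then show "1 / real (totient e) = real (totient (K div e)) / real (totient K)"
      using totient_dvd_mult[OF sqK e] by auto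
  qed simp
  also have "\<dots> = real K / real (totient K)"
    using sum_totient_div[OF K0] by (metis of_nat_sum sum_divide_distrib)
  finally show ?thesis by (simp add: ratio)
qed

section \<open>Comparison of the Selberg sum with the harmonic sum\<close>

text \<open>A truncated Euler product, one factor per prime: an admissible \<open>n\<close> either
  avoids \<open>q\<close> or is \<open>q\<close> times an admissible number.\<close>

lemma sum_inverse_smooth_le:
  assumes "finite P" "\<And>p. p \<in> P \<Longrightarrow> prime (p::nat)"
  shows "(\<Sum>n | n > 0 \<and> n \<le> N \<and> prime_factors n \<subseteq> P. 1 / real n) \<le> (\<Prod>p\<in>P. 1 / (1 - 1 / real p))"
  using assms
proof (induction P rule: finite_induct)
  case empty
  have "{n::nat. n > 0 \<and> n \<le> N \<and> prime_factors n \<subseteq> {}} \<subseteq> {1}"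
    by (auto simp: prime_factorization_empty_iff)
  then have "(\<Sum>n | n > 0 \<and> n \<le> N \<and> prime_factors n \<subseteq> {}. 1 / real n) \<le> (\<Sum>n\<in>{1}. 1 / real n)"
    by (intro sum_mono2) auto
  then show ?case by simp
next
  case (insert q P)
  let ?A = "\<lambda>P. {n. n > 0 \<and> n \<le> N \<and> prime_factors n \<subseteq> P}"
  let ?F = "\<lambda>P. \<Sum>n\<in>?A P. 1 / real n"
  have q: "prime q" using insert.prems by simp
  have q1: "q > 1" using q prime_gt_1_nat by blast
  have fin: "finite (?A P)" for P by (rule finite_subset[of _ "{..N}"]) auto
  have split: "?A (insert q P) \<subseteq> ?A P \<union> (\<lambda>n. q * n) ` ?A (insert q P)"
  proof
    fix n assume n: "n \<in> ?A (insert q P)"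
    show "n \<in> ?A P \<union> (\<lambda>n. q * n) ` ?A (insert q P)"
    proof (cases "q dvd n")
      case True
      then obtain m where m: "n = q * m" by blast
      then have "m > 0" "m \<le> N" using n q1 by (auto intro: le_trans[of _ "q * m"] Nat.gr0I)
      moreover have "prime_factors m \<subseteq> prime_factors n" using m n
        by (intro dvd_prime_factors) auto
      ultimately have "m \<in> ?A (insert q P)" using n by auto
      then show ?thesis using m by blast
    next
      case False
      then have "q \<notin> prime_factors n" by auto
      then show ?thesis using n by auto
    qed
  qed
  have inj: "inj_on (\<lambda>n. q * n) (?A (insert q P))" using q1 by (auto intro: inj_onI)
  have "?F (insert q P) \<le> (\<Sum>n\<in>?A P \<union> (\<lambda>n. q * n) ` ?A (insert q P). 1 / real n)"
    by (intro sum_mono2 split) (auto simp: fin)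
  also have "\<dots> \<le> ?F P + (\<Sum>n\<in>(\<lambda>n. q * n) ` ?A (insert q P). 1 / real n)"
    using sum.union_inter[of "?A P" "(\<lambda>n. q * n) ` ?A (insert q P)" "\<lambda>n. 1 / real n"] fin
      sum_nonneg[of "?A P \<inter> (\<lambda>n. q * n) ` ?A (insert q P)" "\<lambda>n. 1 / real n"] by simp
  also have "(\<Sum>n\<in>(\<lambda>n. q * n) ` ?A (insert q P). 1 / real n) = ?F (insert q P) / real q"
    by (subst sum.reindex[OF inj]) (simp add: o_def sum_divide_distrib mult.commute)
  \<comment> \<open>The sum is bounded by \<open>?F P\<close> plus \<open>1 / q\<close> times
    itself; being finite, it can be moved to the left, which produces the Euler factor of
    \<open>q\<close>.\<close>
  finally have "?F (insert q P) * (1 - 1 / real q) \<le> ?F P" by (simp add: field_simps)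
  then have "?F (insert q P) \<le> ?F P * (1 / (1 - 1 / real q))" using q1 by (simp add: field_simps)
  also have "\<dots> \<le> (\<Prod>p\<in>P. 1 / (1 - 1 / real p)) * (1 / (1 - 1 / real q))"
    using insert q1 by (intro mult_right_mono) auto
  finally show ?case using insert.hyps by (simp add: mult.commute)
qed

text \<open>For squarefree \<open>m\<close>, \<open>1 / totient m\<close> is the sum of
  \<open>1 / n\<close> over all \<open>n\<close> with radical \<open>m\<close>, so the terms of
  \<open>harm N\<close> are grouped by radical. Each \<open>n\<close> is encoded as its radical and
  the cofactor, whose primes all divide the radical.\<close>

lemma harm_le_sieve_mass_1: "harm N \<le> sieve_mass 1 N"
proof -
  define rad where "rad = (\<lambda>n::nat. \<Prod>(prime_factors n))"
  have rad_dvd: "rad n dvd n" if "n > 0" for n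
  proof -
    have "rad n dvd (\<Prod>p\<in>prime_factors n. p ^ multiplicity p n)"
      unfolding rad_def by (intro prod_dvd_prod) (auto simp: prime_factors_multiplicity intro!: dvd_power)
    then show ?thesis using prime_factorization_nat[of n] that by simp
  qed
  have rad_sq: "squarefree (rad n)" for n unfolding rad_def
    by (intro squarefree_prod_coprime) (auto intro: primes_coprime squarefree_prime)
  have pf_rad: "prime_factors (rad n) = prime_factors n" for n
    unfolding rad_def by (subst prime_factors_prod) (auto simp: prime_factorization_prime in_prime_factors_imp_prime)
  define T where "T = (\<lambda>m. {t. t > 0 \<and> t \<le> N \<and> prime_factors t \<subseteq> prime_factors m})"
  have finT: "finite (T m)" for m unfolding T_def by (rule finite_subset[of _ "{..N}"]) auto
  define \<phi> where "\<phi> = (\<lambda>n. (rad n, n div rad n))"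
  have sub: "\<phi> ` {1..N} \<subseteq> Sigma (sieve_support 1 N) T"
  proof (rule image_subsetI)
    fix n assume n: "n \<in> {1..N}"
    then have n0: "n > 0" by simp
    have "rad n > 0" by (rule squarefree_nat_pos[OF rad_sq])
    have "rad n \<le> N" using dvd_imp_le[OF rad_dvd[OF n0] n0] n by simp
    moreover have "n div rad n > 0" using rad_dvd[OF n0] n0 dvd_div_pos by blast
    moreover have "n div rad n \<le> N" using n div_le_dividend order_trans atLeastAtMost_iff by metis
    moreover have "prime_factors (n div rad n) \<subseteq> prime_factors n"
      using rad_dvd[OF n0] n0 div_dvd_self by (intro dvd_prime_factors) auto
    ultimately show "\<phi> n \<in> Sigma (sieve_support 1 N) T"
      by (auto simp: \<phi>_def sieve_support_def T_def rad_sq pf_rad)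
  qed
  have prod: "rad n * (n div rad n) = n" if "n > 0" for n using rad_dvd[OF that] by simp
  have inj: "inj_on \<phi> {1..N}"
    by (rule inj_onI) (simp add: \<phi>_def, metis prod less_eq_Suc_le)
  have "harm N = (\<Sum>n\<in>{1..N}. 1 / real n)" by (simp add: harm_def inverse_eq_divide)
  also have "\<dots> = (\<Sum>n\<in>{1..N}. case \<phi> n of (m, t) \<Rightarrow> 1 / real m * (1 / real t))"
  proof (rule sum.cong)
    fix n assume "n \<in> {1..N}"
    then have "real n = real (rad n) * real (n div rad n)" using prod[of n] by (metis of_nat_mult atLeastAtMost_iff less_eq_Suc_le One_nat_def)
    then show "1 / real n = (case \<phi> n of (m, t) \<Rightarrow> 1 / real m * (1 / real t))" by (simp add: \<phi>_def)
  qed simp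
  also have "\<dots> = (\<Sum>(m, t)\<in>\<phi> ` {1..N}. 1 / real m * (1 / real t))"
    by (subst sum.reindex[OF inj]) (simp add: o_def)
  also have "\<dots> \<le> (\<Sum>(m, t)\<in>Sigma (sieve_support 1 N) T. 1 / real m * (1 / real t))"
    by (intro sum_mono2 sub) (auto intro: finT)
  also have "\<dots> = (\<Sum>m\<in>sieve_support 1 N. \<Sum>t\<in>T m. 1 / real m * (1 / real t))"
    by (rule sum.Sigma[symmetric]) (auto intro: finT)
  also have "\<dots> = (\<Sum>m\<in>sieve_support 1 N. 1 / real m * (\<Sum>t\<in>T m. 1 / real t))"
    by (simp add: sum_distrib_left)
  also have "\<dots> \<le> (\<Sum>m\<in>sieve_support 1 N. 1 / real (totient m))"
  proof (rule sum_mono)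
    fix m assume m: "m \<in> sieve_support 1 N"
    have "(\<Sum>t\<in>T m. 1 / real t) \<le> (\<Prod>p\<in>prime_factors m. 1 / (1 - 1 / real p))"
      unfolding T_def by (rule sum_inverse_smooth_le) auto
    also have "\<dots> = real m / real (totient m)"
      using sieve_support_pos[OF m] by (simp add: totient_formula2 prod_dividef)
    finally show "1 / real m * (\<Sum>t\<in>T m. 1 / real t) \<le> 1 / real (totient m)"
      using sieve_support_pos[OF m] by (simp add: field_simps)
  qed
  finally show ?thesis unfolding sieve_mass_def .
qed

section \<open>Selberg's weights\<close>

text \<open>Agrees with the Moebius function at squarefree arguments, where its sums are taken.
  Without the value 0 elsewhere, its absolute value is always 1.\<close>

definition prime_sign :: "nat \<Rightarrow> real" where
  "prime_sign d = (-1) ^ card (prime_factors d)"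

lemma abs_prime_sign [simp]: "\<bar>prime_sign d\<bar> = 1"
  by (simp add: prime_sign_def power_abs)

lemma prime_sign_mult_coprime:
  assumes "coprime a b" "a > 0" "b > 0"
  shows "prime_sign (a * b) = prime_sign a * prime_sign b"
proof -
  have "prime_factors (a * b) = prime_factors a \<union> prime_factors b"
    using assms by (simp add: prime_factors_product)
  moreover have "prime_factors a \<inter> prime_factors b = {}"
    using assms(1) by (auto simp: in_prime_factors_iff dest: coprime_common_divisor)
  ultimately show ?thesis
    by (simp add: prime_sign_def card_Un_disjoint power_add)
qed

lemma sum_divisors_prime_mult:
  fixes f :: "nat \<Rightarrow> real"
  assumes "prime p" "\<not> p dvd M" "M > 0"
  shows "(\<Sum>d | d dvd p * M. f d) = (\<Sum>d | d dvd M. f d) + (\<Sum>d | d dvd M. f (p * d))"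
proof -
  have p0: "p > 0" using assms(1) prime_gt_0_nat by blast
  have np: "\<not> p dvd d" if "d dvd M" for d using assms(2) that dvd_trans by blast
  have eq: "{d. d dvd p * M} = {d. d dvd M} \<union> (\<lambda>d. p * d) ` {d. d dvd M}"
  proof (intro equalityI subsetI)
    fix d assume d: "d \<in> {d. d dvd p * M}"
    show "d \<in> {d. d dvd M} \<union> (\<lambda>d. p * d) ` {d. d dvd M}"
    proof (cases "p dvd d")
      case True
      then show ?thesis using d p0 by auto
    next
      case False
      then have "coprime d p" using assms(1) prime_imp_coprime coprime_commute by blast
      then show ?thesis using d by (simp add: coprime_dvd_mult_right_iff)
    qed
  qed auto
  have inj: "inj_on (\<lambda>d. p * d) {d. d dvd M}" using p0 by (auto intro: inj_onI)
  have "(\<Sum>d | d dvd p * M. f d) = (\<Sum>d | d dvd M. f d) + (\<Sum>d\<in>(\<lambda>d. p * d) ` {d. d dvd M}. f d)"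
    unfolding eq by (rule sum.union_disjoint) (use assms np in auto)
  also have "(\<Sum>d\<in>(\<lambda>d. p * d) ` {d. d dvd M}. f d) = (\<Sum>d | d dvd M. f (p * d))"
    by (subst sum.reindex[OF inj]) simp
  finally show ?thesis .
qed

text \<open>For a prime \<open>p\<close> dividing \<open>M\<close>, the divisors \<open>d\<close>
  and \<open>p * d\<close> cancel.\<close>

lemma sum_prime_sign_divisors:
  assumes "squarefree M" "M > 1"
  shows "(\<Sum>d | d dvd M. prime_sign d) = 0"
proof -
  obtain p where p: "prime p" "p dvd M" using prime_factor_nat[of M] assms by auto
  then obtain M' where M: "M = p * M'" by blast
  have pos: "M' > 0" "p > 0" using M assms by (auto intro!: Nat.gr0I)
  have "coprime p M'" using squarefree_coprime_div[OF assms(1) p(2)] M pos by simp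
  then have np: "\<not> p dvd d" if "d dvd M'" for d
    using p(1) that by (meson coprime_common_divisor dvd_trans dvd_refl not_prime_unit)
  have neg: "prime_sign (p * d) = - prime_sign d" if "d dvd M'" for d
  proof -
    have "coprime p d" using np[OF that] p(1) prime_imp_coprime by blast
    moreover have "d > 0" using that pos by (auto intro: Nat.gr0I)
    ultimately have "prime_sign (p * d) = prime_sign p * prime_sign d"
      using prime_sign_mult_coprime pos by blast
    then show ?thesis using p(1) by (simp add: prime_sign_def prime_factorization_prime)
  qed
  show ?thesis using sum_divisors_prime_mult[OF p(1) np[OF dvd_refl] pos(1), of prime_sign]
    by (simp add: M neg sum_negf)
qed

text \<open>Moebius inversion over multiples: with \<open>d = r * d'\<close> the sum becomes
  \<open>prime_sign r\<close> times the full divisor sum of \<open>m div r\<close>.\<close>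

lemma sum_prime_sign_between:
  assumes "squarefree m" "r dvd m"
  shows "(\<Sum>d | r dvd d \<and> d dvd m. prime_sign d) = (if m = r then prime_sign r else 0)"
proof -
  have m0: "m > 0" using assms squarefree_nat_pos by blast
  have r0: "r > 0" using assms m0 by (auto intro: Nat.gr0I)
  have eq: "{d. r dvd d \<and> d dvd m} = (\<lambda>d. r * d) ` {d. d dvd m div r}"
    using assms(2) r0 by (auto elim!: dvdE)
  have inj: "inj_on (\<lambda>d. r * d) {d. d dvd m div r}" using r0 by (auto intro: inj_onI)
  have cop: "coprime r (m div r)" using squarefree_coprime_div[OF assms] .
  have q0: "m div r > 0" using assms(2) m0 dvd_div_pos by blast
  have "(\<Sum>d | r dvd d \<and> d dvd m. prime_sign d) = (\<Sum>d | d dvd m div r. prime_sign (r * d))"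
    unfolding eq by (subst sum.reindex[OF inj]) simp
  also have "\<dots> = (\<Sum>d | d dvd m div r. prime_sign r * prime_sign d)"
  proof (rule sum.cong)
    fix d assume "d \<in> {d. d dvd m div r}"
    then have "d dvd m div r" by simp
    moreover from this have "d > 0" using q0 by (auto intro: Nat.gr0I)
    ultimately show "prime_sign (r * d) = prime_sign r * prime_sign d"
      using r0 coprime_divisors[OF dvd_refl _ cop] by (intro prime_sign_mult_coprime) auto
  qed simp
  also have "\<dots> = prime_sign r * (\<Sum>d | d dvd m div r. prime_sign d)"
    by (simp add: sum_distrib_left)
  also have "\<dots> = (if m = r then prime_sign r else 0)"
  proof (cases "m = r")
    case True
    then show ?thesis using r0 by (simp add: prime_sign_def)
  next
    case False
    then have "m div r > 1" using q0 assms(2) by (metis One_nat_def Suc_lessI dvd_div_mult_self mult_1)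
    moreover have "squarefree (m div r)" using assms squarefree_mono div_dvd_self by blast
    ultimately show ?thesis using sum_prime_sign_divisors False by simp
  qed
  finally show ?thesis .
qed

text \<open>Selberg's minimiser of the quadratic form in \<open>selberg_weight_form\<close> under
  the condition that the weight at 1 is 1. Substituting \<open>m = d * n\<close> in
  \<open>sieve_mass_dvd\<close> gives the classical form,
  \<open>prime_sign d * d / totient d\<close> times a sum of \<open>1 / totient n\<close> over
  squarefree \<open>n <= N / d\<close> coprime to \<open>d * k\<close>, divided by the full
  sum.\<close>

definition selberg_weight :: "nat \<Rightarrow> nat \<Rightarrow> nat \<Rightarrow> real" where
  "selberg_weight k N d = prime_sign d * real d * sieve_mass_dvd k N d / sieve_mass k N"

lemma selberg_weight_1: "N \<ge> 1 \<Longrightarrow> selberg_weight k N 1 = 1"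
  using sieve_mass_pos[of N k]
  by (simp add: selberg_weight_def prime_sign_def sieve_mass_dvd_def sieve_mass_def)

lemma abs_selberg_weight:
  "N \<ge> 1 \<Longrightarrow> \<bar>selberg_weight k N d\<bar> = real d * sieve_mass_dvd k N d / sieve_mass k N"
  using sieve_mass_pos[of N k] sieve_mass_dvd_nonneg[of k N d]
  by (simp add: selberg_weight_def abs_mult)

lemma abs_selberg_weight_le_1:
  "N \<ge> 1 \<Longrightarrow> d \<in> sieve_support k N \<Longrightarrow> \<bar>selberg_weight k N d\<bar> \<le> 1"
  using sieve_mass_pos[of N k] sieve_mass_dvd_le[of d k N] by (simp add: abs_selberg_weight)

text \<open>Interchange of summation; the support is closed under divisors, so the inner sum runs
  over all divisors of \<open>m\<close>. It is applied with \<open>g d = d\<close> for the absolute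
  weights, with signs on the multiples of \<open>r\<close> for the diagonal variables, and with
  \<open>g d = 1 / d\<close>.\<close>

lemma sum_sieve_support_dvd_swap:
  "(\<Sum>d\<in>sieve_support k N. g d * sieve_mass_dvd k N d)
     = (\<Sum>m\<in>sieve_support k N. (\<Sum>d | d dvd m. g d) / real (totient m))"
proof -
  let ?D = "sieve_support k N"
  have "(\<Sum>d\<in>?D. g d * sieve_mass_dvd k N d)
      = (\<Sum>d\<in>?D. \<Sum>m\<in>?D. if d dvd m then g d / real (totient m) else 0)"
    unfolding sieve_mass_dvd_def sum_distrib_left
    by (rule sum.cong[OF refl], subst sum.inter_filter) (auto intro!: sum.cong)
  also have "\<dots> = (\<Sum>m\<in>?D. \<Sum>d\<in>?D. if d dvd m then g d / real (totient m) else 0)"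
    by (rule sum.swap)
  also have "\<dots> = (\<Sum>m\<in>?D. (\<Sum>d | d dvd m. g d) / real (totient m))"
  proof (rule sum.cong)
    fix m assume m: "m \<in> ?D"
    have "{d \<in> ?D. d dvd m} = {d. d dvd m}" using sieve_support_dvd[OF m] by auto
    then show "(\<Sum>d\<in>?D. if d dvd m then g d / real (totient m) else 0)
        = (\<Sum>d | d dvd m. g d) / real (totient m)"
      by (simp add: sum.inter_filter[symmetric] sum_divide_distrib)
  qed simp
  finally show ?thesis .
qed

lemma sum_abs_selberg_weight:
  assumes "N \<ge> 1"
  shows "(\<Sum>d\<in>sieve_support k N. \<bar>selberg_weight k N d\<bar>)
    = (\<Sum>m\<in>sieve_support k N. (\<Sum>d | d dvd m. real d) / real (totient m)) / sieve_mass k N"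
  using assms sum_sieve_support_dvd_swap[of real k N]
  by (simp add: abs_selberg_weight sum_divide_distrib[symmetric])

text \<open>The left side is the variable in which the quadratic form becomes diagonal. After the
  interchange a Moebius sum over the \<open>d\<close> between \<open>r\<close> and \<open>m\<close>
  remains, and only \<open>m = r\<close> survives.\<close>

lemma selberg_weight_diagonal:
  assumes r: "r \<in> sieve_support k N"
  shows "(\<Sum>d\<in>sieve_support k N. if r dvd d then selberg_weight k N d / real d else 0)
      = prime_sign r / (real (totient r) * sieve_mass k N)"
proof -
  let ?D = "sieve_support k N"
  have "(\<Sum>d\<in>?D. if r dvd d then selberg_weight k N d / real d else 0)
      = (\<Sum>d\<in>?D. (if r dvd d then prime_sign d else 0) * sieve_mass_dvd k N d) / sieve_mass k N"
    unfolding sum_divide_distrib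
    by (intro sum.cong refl) (use sieve_support_pos in \<open>auto simp: selberg_weight_def\<close>)
  also have "(\<Sum>d\<in>?D. (if r dvd d then prime_sign d else 0) * sieve_mass_dvd k N d)
      = (\<Sum>m\<in>?D. (\<Sum>d | d dvd m. if r dvd d then prime_sign d else 0) / real (totient m))"
    by (rule sum_sieve_support_dvd_swap)
  also have "\<dots> = (\<Sum>m\<in>?D. if m = r then prime_sign r / real (totient r) else 0)"
  proof (rule sum.cong)
    fix m assume m: "m \<in> ?D"
    then have m': "squarefree m" "m > 0" by (auto simp: sieve_support_def squarefree_nat_pos)
    have eq: "(\<Sum>d | d dvd m. if r dvd d then prime_sign d else 0) = (\<Sum>d | r dvd d \<and> d dvd m. prime_sign d)"
      using m' by (simp add: sum.inter_filter[symmetric] conj_commute)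
    show "(\<Sum>d | d dvd m. if r dvd d then prime_sign d else 0) / real (totient m)
        = (if m = r then prime_sign r / real (totient r) else 0)"
    proof (cases "r dvd m")
      case True
      then show ?thesis using sum_prime_sign_between[OF m'(1) True] eq by simp
    next
      case False
      then have "{d. r dvd d \<and> d dvd m} = {}" using dvd_trans by auto
      then show ?thesis using False by (simp only: eq) auto
    qed
  qed simp
  also have "\<dots> = prime_sign r / real (totient r)" using r by simp
  finally show ?thesis by simp
qed

text \<open>\<open>1 / lcm d e = gcd d e / (d * e)\<close>, and the gcd is the sum of
  \<open>totient r\<close> over the common divisors \<open>r\<close>. So the form is the sum of
  \<open>totient r\<close> times the squared diagonal variable, that is
  \<open>1 / (totient r * S)^2\<close> with \<open>S = sieve_mass k N\<close>, and the total is
  \<open>S / S^2\<close>.\<close>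

lemma selberg_weight_form:
  assumes "N \<ge> 1"
  shows "(\<Sum>d\<in>sieve_support k N. \<Sum>e\<in>sieve_support k N.
      selberg_weight k N d * selberg_weight k N e / real (lcm d e)) = 1 / sieve_mass k N"
proof -
  let ?D = "sieve_support k N" and ?S = "sieve_mass k N"
  let ?v = "\<lambda>d. selberg_weight k N d / real d"
  have S: "?S > 0" using sieve_mass_pos[OF assms] .
  have lcm: "1 / real (lcm d e) = (\<Sum>r\<in>?D. if r dvd d \<and> r dvd e then real (totient r) else 0) / (real d * real e)"
    if "d \<in> ?D" "e \<in> ?D" for d e
  proof -
    have "{r \<in> ?D. r dvd d \<and> r dvd e} = {r. r dvd gcd d e}"
      using sieve_support_dvd[OF that(1)] by auto
    then have "(\<Sum>r\<in>?D. if r dvd d \<and> r dvd e then real (totient r) else 0) = real (gcd d e)"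
      using totient_divisor_sum[of "gcd d e"]
      by (simp add: sum.inter_filter[symmetric] flip: of_nat_sum)
    moreover have "real (gcd d e) * real (lcm d e) = real d * real e"
      by (metis of_nat_mult prod_gcd_lcm_nat)
    moreover have "lcm d e > 0" using that sieve_support_pos by (simp add: lcm_pos_nat)
    ultimately show ?thesis using sieve_support_pos that by (auto simp: field_simps)
  qed
  have "(\<Sum>d\<in>?D. \<Sum>e\<in>?D. selberg_weight k N d * selberg_weight k N e / real (lcm d e))
      = (\<Sum>d\<in>?D. \<Sum>e\<in>?D. \<Sum>r\<in>?D. real (totient r) * ((if r dvd d then ?v d else 0) * (if r dvd e then ?v e else 0)))"
  proof (intro sum.cong refl)
    fix d e assume de: "d \<in> ?D" "e \<in> ?D"
    have "selberg_weight k N d * selberg_weight k N e / real (lcm d e)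
       = selberg_weight k N d * selberg_weight k N e * (1 / real (lcm d e))" by simp
    also have "\<dots> = ?v d * ?v e * (\<Sum>r\<in>?D. if r dvd d \<and> r dvd e then real (totient r) else 0)"
      unfolding lcm[OF de] by simp
    also have "\<dots> = (\<Sum>r\<in>?D. real (totient r) * ((if r dvd d then ?v d else 0) * (if r dvd e then ?v e else 0)))"
      unfolding sum_distrib_left by (intro sum.cong refl) auto
    finally show "selberg_weight k N d * selberg_weight k N e / real (lcm d e) = \<dots>" .
  qed
  also have "\<dots> = (\<Sum>r\<in>?D. \<Sum>d\<in>?D. \<Sum>e\<in>?D. real (totient r) * ((if r dvd d then ?v d else 0) * (if r dvd e then ?v e else 0)))"
    by (subst sum.swap, subst (2) sum.swap) (rule refl)
  also have "\<dots> = (\<Sum>r\<in>?D. real (totient r) * (\<Sum>d\<in>?D. if r dvd d then ?v d else 0)\<^sup>2)"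
    by (rule sum.cong[OF refl]) (simp only: power2_eq_square sum_product, simp only: sum_distrib_left)
  also have "\<dots> = (\<Sum>r\<in>?D. (1 / real (totient r)) / ?S\<^sup>2)"
  proof (intro sum.cong refl)
    fix r assume r: "r \<in> ?D"
    have "(prime_sign r)\<^sup>2 = 1" by (metis abs_prime_sign power2_abs power_one)
    then show "real (totient r) * (\<Sum>d\<in>?D. if r dvd d then ?v d else 0)\<^sup>2 = (1 / real (totient r)) / ?S\<^sup>2"
      unfolding selberg_weight_diagonal[OF r] using sieve_support_pos[OF r] S
      by (simp add: power_divide power_mult_distrib field_simps power2_eq_square)
  qed
  also have "\<dots> = ?S / ?S\<^sup>2"
    by (simp add: sieve_mass_def sum_divide_distrib)
  also have "\<dots> = 1 / ?S" using S by (simp add: power2_eq_square)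
  finally show ?thesis .
qed

section \<open>The sum of the absolute weights\<close>

lemma prod_primes_dvd:
  fixes m :: nat
  assumes "finite P" "\<And>p. p \<in> P \<Longrightarrow> prime p \<and> p dvd m"
  shows "\<Prod>P dvd m"
  using assms
proof (induction P rule: finite_induct)
  case (insert q P)
  have "coprime q (\<Prod>P)"
    using insert by (intro prod_coprime_right) (auto intro: primes_coprime)
  then show ?case using insert by (simp add: divides_mult)
qed simp

text \<open>Row \<open>2 * m + 1\<close> has two equal middle entries, which together are at most
  the row sum \<open>2 * 4 ^ m\<close>.\<close>

lemma central_binomial_le: "(2 * m + 1) choose m \<le> (4::nat) ^ m"
proof -
  have "(\<Sum>k\<in>{m, m + 1}. (2 * m + 1) choose k) \<le> (\<Sum>k\<le>2 * m + 1. (2 * m + 1) choose k)"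
    by (intro sum_mono2) auto
  moreover have "(2 * m + 1) choose (m + 1) = (2 * m + 1) choose m"
    by (subst binomial_symmetric) auto
  ultimately have "2 * ((2 * m + 1) choose m) \<le> 2 ^ (2 * m + 1)"
    by (simp add: choose_row_sum del: binomial_Suc_Suc sum.atMost_Suc)
  then show ?thesis by (simp add: power_mult del: binomial_Suc_Suc)
qed

text \<open>Erdos's argument: for \<open>n = 2 * m + 1\<close> the primes in
  \<open>(m + 1, 2 * m + 1]\<close> all divide the binomial coefficient of
  \<open>central_binomial_le\<close>, and the smaller primes are covered by induction at
  \<open>m + 1\<close>. An even \<open>n > 2\<close> is not prime and reduces to
  \<open>n - 1\<close>.\<close>

lemma primorial_le: "\<Prod>{p::nat. prime p \<and> p \<le> n} \<le> 4 ^ n"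
proof (induction n rule: less_induct)
  case (less n)
  let ?P = "\<lambda>n. {p::nat. prime p \<and> p \<le> n}"
  consider "n \<le> 1" | "n = 2" | "n > 2" "even n" | "n > 2" "odd n" by linarith
  then show ?case
  proof cases
    case 1
    then have "?P n = {}" by (auto dest: prime_gt_1_nat)
    then show ?thesis by (simp only: prod.empty) simp
  next
    case 2
    then have "?P n = {2}" by (auto dest: prime_ge_2_nat)
    then show ?thesis using 2 by simp
  next
    case 3
    have "?P n = ?P (n - 1)"
    proof safe
      fix p assume "prime p" "p \<le> n"
      moreover have "p \<noteq> n" using 3 \<open>prime p\<close> prime_odd_nat by auto
      ultimately show "p \<le> n - 1" by simp
    qed simp
    then have "\<Prod>(?P n) \<le> 4 ^ (n - 1)" using less.IH[of "n - 1"] 3 by simp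
    also have "\<dots> \<le> 4 ^ n" by (rule power_increasing) auto
    finally show ?thesis .
  next
    case 4
    then obtain m where m: "n = 2 * m + 1" by (elim oddE)
    then have m1: "m \<ge> 1" using 4 by simp
    let ?Q = "{p. prime p \<and> m + 1 < p \<and> p \<le> 2 * m + 1}"
    have "\<Prod>?Q dvd ((2 * m + 1) choose m)"
    proof (rule prod_primes_dvd)
      fix p assume "p \<in> ?Q"
      then have p: "prime p" "m + 1 < p" "p \<le> 2 * m + 1" by auto
      have "fact m * fact (m + 1) * ((2 * m + 1) choose m) = (fact (2 * m + 1) :: nat)"
        using binomial_fact_lemma[of m "2 * m + 1"] by (simp add: mult.commute del: fact_Suc binomial_Suc_Suc)
      moreover have "p dvd (fact (2 * m + 1) :: nat)" by (subst prime_dvd_fact_iff) (use p in auto)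
      ultimately have "p dvd fact m * fact (m + 1) * ((2 * m + 1) choose m)" by (simp only:)
      moreover have "\<not> p dvd (fact m :: nat)" by (subst prime_dvd_fact_iff) (use p in auto)
      moreover have "\<not> p dvd (fact (m + 1) :: nat)" by (subst prime_dvd_fact_iff) (use p in auto)
      ultimately show "prime p \<and> p dvd ((2 * m + 1) choose m)"
        using p(1) prime_dvd_mult_iff by blast
    qed simp
    then have Q: "\<Prod>?Q \<le> 4 ^ m"
      using dvd_imp_le[of "\<Prod>?Q" "(2 * m + 1) choose m"] central_binomial_le[of m] by simp
    have "?P n = ?P (m + 1) \<union> ?Q" using m by auto
    then have "\<Prod>(?P n) = \<Prod>(?P (m + 1)) * \<Prod>?Q"
      by (simp only:, intro prod.union_disjoint) auto
    also have "\<dots> \<le> 4 ^ (m + 1) * 4 ^ m"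
      using less.IH[of "m + 1"] m m1 Q by (intro mult_mono) auto
    also have "\<dots> = 4 ^ n" by (simp add: m power_add[symmetric] mult_2)
    finally show ?thesis .
  qed
qed

lemma sum_ln_primes_le: "(\<Sum>p | prime p \<and> p \<le> n. ln (real p)) \<le> real n * ln 4"
proof -
  let ?P = "{p::nat. prime p \<and> p \<le> n}"
  have "(\<Sum>p\<in>?P. ln (real p)) = ln (\<Prod>p\<in>?P. real p)"
    by (rule ln_prod[symmetric]) (auto dest: prime_gt_0_nat)
  also have "(\<Prod>p\<in>?P. real p) = real (\<Prod>?P)" by simp
  also have "ln (real (\<Prod>?P)) \<le> ln (real (4 ^ n))"
  proof (rule ln_mono)
    show "0 < real (\<Prod>?P)" by (auto intro!: prod_pos dest: prime_gt_0_nat)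
    show "real (\<Prod>?P) \<le> real (4 ^ n)" using primorial_le[of n] by (simp only: of_nat_le_iff)
  qed
  also have "\<dots> = real n * ln 4" by (simp add: ln_realpow)
  finally show ?thesis .
qed

text \<open>Use \<open>ln s <= s - 1\<close> at \<open>s = t / 2\<close>; the leftover
  \<open>ln 2 - 1\<close> is negative. The factor 1/2 helps to keep the constant in
  \<open>sum_divisor_ratio_le\<close> at 8.\<close>

lemma ln_le_half: "t > 0 \<Longrightarrow> ln t \<le> t / (2::real)"
  using ln_le_minus_one[of "t / 2"] ln_2_less_1 by (simp add: ln_div)

text \<open>The first term is exact, and for \<open>n >= 2\<close> the bound
  \<open>1 / n^2 <= 1 / (n - 1/2) - 1 / (n + 1/2)\<close> telescopes to at most 2/3.\<close>

lemma sum_inverse_squares_le: "(\<Sum>n=1..N. 1 / (real n)\<^sup>2) \<le> 5 / 3"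
proof (cases N)
  case (Suc M)
  have "(\<Sum>n=1..Suc M. 1 / (real n)\<^sup>2) \<le> 5 / 3 - 1 / (real (Suc M) + 1 / 2)"
  proof (induction M)
    case (Suc M)
    have "1 / (real (Suc (Suc M)))\<^sup>2 \<le> 1 / (real (Suc M) + 1 / 2) - 1 / (real (Suc (Suc M)) + 1 / 2)"
    proof -
      define x where "x = real M"
      have x: "x \<ge> 0" by (simp add: x_def)
      have "(x + 3 / 2) * (x + 5 / 2) \<le> (x + 2)\<^sup>2" by (simp add: power2_eq_square algebra_simps)
      then have "1 / (x + 2)\<^sup>2 \<le> 1 / ((x + 3 / 2) * (x + 5 / 2))"
        using x by (intro divide_left_mono mult_pos_pos) auto
      also have "\<dots> = 1 / (x + 3 / 2) - 1 / (x + 5 / 2)"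
        using x by (simp add: divide_simps)
      finally show ?thesis by (simp add: x_def add_ac)
    qed
    then show ?case using Suc.IH by simp
  qed simp
  then show ?thesis using Suc by (smt (verit) divide_nonneg_nonneg of_nat_0_le_iff zero_le_divide_1_iff)
qed simp

section \<open>Saving a logarithm in the sum of the absolute weights\<close>

text \<open>By \<open>sum_abs_selberg_weight\<close>, summing this over the support and dividing by
  \<open>sieve_mass k N\<close> gives the sum of the absolute weights.\<close>

definition divisor_ratio :: "nat \<Rightarrow> real" where
  "divisor_ratio m = (\<Sum>d | d dvd m. real d) / real (totient m)"

lemma divisor_ratio_nonneg: "divisor_ratio m \<ge> 0"
  unfolding divisor_ratio_def by (intro divide_nonneg_nonneg sum_nonneg) auto

text \<open>Both functions in the ratio are multiplicative, so the factor is
  \<open>(p + 1) / (p - 1)\<close>, largest at \<open>p = 2\<close>.\<close>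

lemma divisor_ratio_prime_mult:
  assumes "prime p" "\<not> p dvd m" "m > 0"
  shows "divisor_ratio (p * m) \<le> 3 * divisor_ratio m"
proof -
  have p2: "p \<ge> 2" using assms(1) prime_ge_2_nat by blast
  have "coprime p m" using assms prime_imp_coprime by blast
  then have tot: "real (totient (p * m)) = (real p - 1) * real (totient m)"
    using p2 assms(1) by (simp add: totient_mult_coprime totient_prime of_nat_diff)
  have "(\<Sum>d | d dvd p * m. real d) = (1 + real p) * (\<Sum>d | d dvd m. real d)"
    unfolding sum_divisors_prime_mult[OF assms, of real] by (simp add: distrib_right sum_distrib_left[symmetric])
  then have "divisor_ratio (p * m) = (1 + real p) / (real p - 1) * divisor_ratio m"
    by (simp add: divisor_ratio_def tot)
  also have "\<dots> \<le> 3 * divisor_ratio m"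
    using p2 by (intro mult_right_mono divisor_ratio_nonneg) (simp add: field_simps)
  finally show ?thesis .
qed

lemma ln_squarefree:
  assumes "squarefree (m::nat)"
  shows "ln (real m) = (\<Sum>p\<in>prime_factors m. ln (real p))"
proof -
  have m0: "m > 0" using assms by (rule squarefree_nat_pos)
  then have mult: "\<forall>p\<in>prime_factors m. multiplicity p m = 1"
    using assms squarefree_factorial_semiring'[of m] by blast
  have "m = (\<Prod>p\<in>prime_factors m. p ^ multiplicity p m)" by (rule prime_factorization_nat) (use m0 in simp)
  also have "\<dots> = (\<Prod>p\<in>prime_factors m. p)"
    using mult by (intro prod.cong) simp_all
  finally have "real m = real (\<Prod>p\<in>prime_factors m. p)" by (rule arg_cong)
  also have "\<dots> = (\<Prod>p\<in>prime_factors m. real p)" by (rule of_nat_prod)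
  finally have "ln (real m) = ln (\<Prod>p\<in>prime_factors m. real p)" by (rule arg_cong)
  also have "\<dots> = (\<Sum>p\<in>prime_factors m. ln (real p))"
    by (rule ln_prod) (auto dest: in_prime_factors_imp_prime prime_gt_0_nat)
  finally show ?thesis .
qed

text \<open>The divisor sum of \<open>m\<close> divided by \<open>m\<close> is the sum of
  \<open>1 / d\<close> over \<open>d dvd m\<close>. After interchanging,
  \<open>sieve_mass_dvd_le\<close> supplies another \<open>1 / d\<close>, which leaves the sum of
  inverse squares.\<close>

lemma sum_divisor_ratio_over_id_le:
  "(\<Sum>m\<in>sieve_support k N. divisor_ratio m / real m) \<le> 5 / 3 * sieve_mass k N"
proof (cases "N \<ge> 1")
  case True
  have S: "sieve_mass k N > 0" using sieve_mass_pos[OF True] .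
  have "(\<Sum>m\<in>sieve_support k N. divisor_ratio m / real m)
      = (\<Sum>m\<in>sieve_support k N. (\<Sum>d | d dvd m. 1 / real d) / real (totient m))"
  proof (rule sum.cong)
    fix m assume "m \<in> sieve_support k N"
    then have m0: "m > 0" by (rule sieve_support_pos)
    have "(\<Sum>d | d dvd m. real d / real m) = (\<Sum>d | d dvd m. 1 / real d)"
    proof (rule sum.reindex_bij_witness[of _ "\<lambda>d. m div d" "\<lambda>d. m div d"])
      fix d assume "d \<in> {d. d dvd m}"
      then obtain e where e: "m = d * e" by blast
      then have "d > 0" "e > 0" using m0 by auto
      then show "1 / real (m div d) = real d / real m" using e by simp
      show "m div (m div d) = d" using e \<open>d > 0\<close> \<open>e > 0\<close> by simp
      then show "m div (m div d) = d" .
      show "m div d \<in> {d. d dvd m}" using e \<open>d > 0\<close> by simp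
      then show "m div d \<in> {d. d dvd m}" .
    qed
    moreover have "divisor_ratio m / real m = (\<Sum>d | d dvd m. real d / real m) / real (totient m)"
      by (simp add: divisor_ratio_def sum_divide_distrib[symmetric] mult.commute)
    ultimately show "divisor_ratio m / real m = (\<Sum>d | d dvd m. 1 / real d) / real (totient m)" by simp
  qed simp
  also have "\<dots> = (\<Sum>d\<in>sieve_support k N. 1 / real d * sieve_mass_dvd k N d)"
    by (rule sum_sieve_support_dvd_swap[symmetric])
  also have "\<dots> \<le> (\<Sum>d\<in>sieve_support k N. 1 / (real d)\<^sup>2 * sieve_mass k N)"
  proof (rule sum_mono)
    fix d assume d: "d \<in> sieve_support k N"
    then show "1 / real d * sieve_mass_dvd k N d \<le> 1 / (real d)\<^sup>2 * sieve_mass k N"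
      using sieve_mass_dvd_le[OF d] sieve_support_pos[OF d] by (simp add: field_simps power2_eq_square)
  qed
  also have "\<dots> \<le> (\<Sum>d=1..N. 1 / (real d)\<^sup>2 * sieve_mass k N)"
    using S sieve_support_pos
    by (intro sum_mono2) (auto simp: sieve_support_def Suc_le_eq squarefree_nat_pos)
  also have "\<dots> = (\<Sum>d=1..N. 1 / (real d)\<^sup>2) * sieve_mass k N" by (rule sum_distrib_right[symmetric])
  also have "\<dots> \<le> 5 / 3 * sieve_mass k N"
    using S sum_inverse_squares_le by (intro mult_right_mono) auto
  finally show ?thesis .
next
  case False
  then have "sieve_support k N = {}" using sieve_support_pos by (force simp: sieve_support_def)
  then show ?thesis by (simp add: sieve_mass_def)
qed

text \<open>Writing \<open>ln z = ln m + ln (z / m)\<close> and splitting \<open>ln m\<close> over the primes dividing \<open>m\<close>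
  saves a logarithm over the trivial bound, uniformly in \<open>k\<close>.\<close>
lemma sum_divisor_ratio_le:
  assumes "real N \<le> z"
  shows "(\<Sum>m\<in>sieve_support k N. divisor_ratio m) * ln z \<le> 8 * z * sieve_mass k N"
proof (cases "N \<ge> 1")
  case N: True
  let ?D = "sieve_support k N" and ?h = divisor_ratio
  have S: "sieve_mass k N > 0" using sieve_mass_pos[OF N] .
  have z0: "z > 0" using assms N by linarith
  have le: "real m \<le> z" if "m \<in> ?D" for m using that assms by (auto simp: sieve_support_def)
  define A where "A = Sigma ?D prime_factors"
  define B where "B = Sigma ?D (\<lambda>m. {p::nat. prime p \<and> p \<le> N div m})"
  \<comment> \<open>Removing \<open>p\<close> from \<open>m\<close> costs a factor of at most 3 in
    the ratio and lets \<open>p\<close> range over all primes up to \<open>N div (m div p)\<close>,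
    whether or not they divide \<open>m div p\<close>.\<close>
  define \<phi> where "\<phi> = (\<lambda>(m, p). (m div p, p :: nat))"
  have finB: "finite {p::nat. prime p \<and> p \<le> N div m}" for m
    by (rule finite_subset[of _ "{..N div m}"]) auto
  have A: "prime p" "m = p * (m div p)" "m div p > 0" "\<not> p dvd m div p" "m \<le> N" "m \<in> ?D"
    if "(m, p) \<in> A" for m p
  proof -
    from that have m: "m \<in> ?D" "squarefree m" "prime p" "p dvd m" "m > 0" "m \<le> N"
      by (auto simp: A_def sieve_support_def in_prime_factors_iff)
    then show "prime p" "m = p * (m div p)" "m div p > 0" "m \<le> N" "m \<in> ?D"
      using dvd_div_pos by auto
    show "\<not> p dvd m div p" using squarefree_coprime_div[OF m(2,4)] m(3)
      by (meson coprime_common_divisor dvd_refl not_prime_unit)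
  qed
  have inj: "inj_on \<phi> A"
  proof (rule inj_onI)
    fix u v assume uv: "u \<in> A" "v \<in> A" "\<phi> u = \<phi> v"
    obtain m p m' p' where [simp]: "u = (m, p)" "v = (m', p')" by (cases u, cases v)
    have "p = p'" "m div p = m' div p'" using uv(3) by (auto simp: \<phi>_def)
    moreover have "m = p * (m div p)" "m' = p' * (m' div p')" using uv A(2) by auto
    ultimately show "u = v" by simp
  qed
  have sub: "\<phi> ` A \<subseteq> B"
  proof (rule image_subsetI)
    fix u assume "u \<in> A"
    moreover obtain m p where u: "u = (m, p)" by (cases u)
    ultimately have mp: "(m, p) \<in> A" by simp
    have "m div p \<in> ?D" using A[OF mp] sieve_support_dvd by (metis dvd_triv_right)
    moreover have "p \<le> N div (m div p)"
      using A(2,3,5)[OF mp] by (metis less_eq_div_iff_mult_less_eq)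
    ultimately show "\<phi> u \<in> B" using A(1)[OF mp] by (simp add: u \<phi>_def B_def)
  qed
  have "(\<Sum>m\<in>?D. ?h m * ln (real m)) = (\<Sum>m\<in>?D. \<Sum>p\<in>prime_factors m. ?h m * ln (real p))"
    by (intro sum.cong refl) (simp add: ln_squarefree sieve_support_def sum_distrib_left)
  also have "\<dots> = (\<Sum>(m, p)\<in>A. ?h m * ln (real p))"
    unfolding A_def by (rule sum.Sigma) auto
  also have "\<dots> \<le> (\<Sum>u\<in>A. case \<phi> u of (m, p) \<Rightarrow> 3 * ?h m * ln (real p))"
  proof (rule sum_mono)
    fix u assume "u \<in> A"
    moreover obtain m p where u: "u = (m, p)" by (cases u)
    ultimately have mp: "(m, p) \<in> A" by simp
    have "?h m \<le> 3 * ?h (m div p)"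
      using divisor_ratio_prime_mult[OF A(1,4,3)[OF mp]] A(2)[OF mp] by simp
    moreover have "ln (real p) \<ge> 0" using prime_ge_1_nat[OF A(1)[OF mp]] by simp
    ultimately show "(case u of (m, p) \<Rightarrow> ?h m * ln (real p))
        \<le> (case \<phi> u of (m, p) \<Rightarrow> 3 * ?h m * ln (real p))"
      by (simp add: u \<phi>_def mult_right_mono)
  qed
  also have "\<dots> = (\<Sum>(m, p)\<in>\<phi> ` A. 3 * ?h m * ln (real p))"
    by (subst sum.reindex[OF inj]) (simp add: o_def)
  also have "\<dots> \<le> (\<Sum>(m, p)\<in>B. 3 * ?h m * ln (real p))"
  proof (rule sum_mono2[OF _ sub])
    show "finite B" unfolding B_def by (intro finite_SigmaI finB) simp
    fix u assume "u \<in> B - \<phi> ` A"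
    then show "0 \<le> (case u of (m, p) \<Rightarrow> 3 * ?h m * ln (real p))"
      using prime_ge_1_nat by (auto simp: B_def intro!: mult_nonneg_nonneg divisor_ratio_nonneg)
  qed
  also have "\<dots> = (\<Sum>m\<in>?D. \<Sum>p | prime p \<and> p \<le> N div m. 3 * ?h m * ln (real p))"
    unfolding B_def by (rule sum.Sigma[symmetric]) (auto intro: finB)
  \<comment> \<open>The Chebyshev bound for the primes up to \<open>N div m\<close> contributes
    \<open>z * ln 4 / m\<close>; the divisor \<open>m\<close> makes
    \<open>sum_divisor_ratio_over_id_le\<close> applicable.\<close>
  also have "\<dots> \<le> (\<Sum>m\<in>?D. (3 * ln 4 * z) * (?h m / real m))"
  proof (rule sum_mono)
    fix m assume m: "m \<in> ?D"
    have m0: "m > 0" using sieve_support_pos[OF m] .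
    have "real (N div m) \<le> real N / real m" by (rule of_nat_div_le_of_nat)
    also have "\<dots> \<le> z / real m" using assms m0 by (simp add: divide_right_mono)
    finally have "real (N div m) * ln 4 \<le> z / real m * ln 4" by (intro mult_right_mono) auto
    then have "(\<Sum>p | prime p \<and> p \<le> N div m. ln (real p)) \<le> z / real m * ln 4"
      using sum_ln_primes_le[of "N div m"] by linarith
    then have "3 * ?h m * (\<Sum>p | prime p \<and> p \<le> N div m. ln (real p)) \<le> 3 * ?h m * (z / real m * ln 4)"
      using divisor_ratio_nonneg[of m] by (intro mult_left_mono) auto
    then show "(\<Sum>p | prime p \<and> p \<le> N div m. 3 * ?h m * ln (real p)) \<le> (3 * ln 4 * z) * (?h m / real m)"
      by (simp add: sum_distrib_left mult_ac)
  qed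
  finally have 1: "(\<Sum>m\<in>?D. ?h m * ln (real m)) \<le> (\<Sum>m\<in>?D. (3 * ln 4 * z) * (?h m / real m))" .
  \<comment> \<open>The complementary logarithm is at most \<open>z / (2 * m)\<close>, so this part
    has the same shape as the first.\<close>
  have 2: "(\<Sum>m\<in>?D. ?h m * ln (z / real m)) \<le> (\<Sum>m\<in>?D. (z / 2) * (?h m / real m))"
  proof (rule sum_mono)
    fix m assume m: "m \<in> ?D"
    have "?h m * ln (z / real m) \<le> ?h m * (z / real m / 2)"
      using z0 sieve_support_pos[OF m] by (intro mult_left_mono ln_le_half divisor_ratio_nonneg) auto
    then show "?h m * ln (z / real m) \<le> (z / 2) * (?h m / real m)" by (simp add: mult_ac)
  qed
  have "(\<Sum>m\<in>?D. ?h m) * ln z = (\<Sum>m\<in>?D. ?h m * ln (real m)) + (\<Sum>m\<in>?D. ?h m * ln (z / real m))"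
    unfolding sum_distrib_right sum.distrib[symmetric]
    using z0 sieve_support_pos by (intro sum.cong refl) (auto simp: ln_div algebra_simps)
  also have "\<dots> \<le> (3 * ln 4 + 1 / 2) * z * (\<Sum>m\<in>?D. ?h m / real m)"
    using 1 2 unfolding sum_distrib_left[symmetric] by (simp add: algebra_simps)
  also have "\<dots> \<le> (3 * ln 4 + 1 / 2) * z * (5 / 3 * sieve_mass k N)"
    using z0 by (intro mult_left_mono sum_divisor_ratio_over_id_le) auto
  also have "\<dots> \<le> 8 * z * sieve_mass k N"
  \<comment> \<open>With \<open>ln 2 <= 25/36\<close> the constant is at most
    \<open>14/3 * 5/3 = 70/9\<close>, just below 8.\<close>
  proof -
    have "ln (4::real) = 2 * ln 2" using ln_realpow[of 2 2] by simp
    then have "(3 * ln 4 + 1 / 2) * (5 / 3) \<le> (8::real)" using ln2_le_25_over_36 by simp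
    then have "(3 * ln 4 + 1 / 2) * (5 / 3) * (z * sieve_mass k N) \<le> 8 * (z * sieve_mass k N)"
      using z0 S by (intro mult_right_mono) auto
    then show ?thesis by (simp add: mult_ac)
  qed
  finally show ?thesis .
next
  case False
  then have "sieve_support k N = {}" using sieve_support_pos by (force simp: sieve_support_def)
  then show ?thesis by (simp add: sieve_mass_def)
qed

text \<open>The bound uses a real \<open>z\<close> above the integer level \<open>N\<close>, so that
  \<open>z\<close> can later be an exponential with an explicit logarithm.\<close>

lemma sum_abs_selberg_weight_le:
  assumes "N \<ge> 1" "real N \<le> z" "z > 1"
  shows "(\<Sum>d\<in>sieve_support k N. \<bar>selberg_weight k N d\<bar>) \<le> 8 * z / ln z"
  using sum_divisor_ratio_le[OF assms(2), of k] sieve_mass_pos[OF assms(1), of k] assms(3)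
  by (simp add: sum_abs_selberg_weight[OF assms(1)] divisor_ratio_def field_simps)

lemma sum_abs_selberg_weight_le_card:
  assumes "N \<ge> 1"
  shows "(\<Sum>d\<in>sieve_support k N. \<bar>selberg_weight k N d\<bar>) \<le> real N"
proof -
  have "(\<Sum>d\<in>sieve_support k N. \<bar>selberg_weight k N d\<bar>) \<le> (\<Sum>d\<in>sieve_support k N. 1)"
    using assms by (intro sum_mono abs_selberg_weight_le_1)
  also have "\<dots> \<le> (\<Sum>d\<in>{1..N}. 1)"
    by (intro sum_mono2) (auto simp: sieve_support_def Suc_le_eq squarefree_nat_pos)
  finally show ?thesis by simp
qed

section \<open>Sums over arithmetic progressions\<close>

lemma abs_integral_le:
  fixes f g :: "real \<Rightarrow> real"
  assumes "f integrable_on S" "g integrable_on S" "\<And>x. x \<in> S \<Longrightarrow> \<bar>f x\<bar> \<le> g x"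
  shows "\<bar>integral S f\<bar> \<le> integral S g"
  using Henstock_Kurzweil_Integration.integral_norm_bound_integral[of f S g] assms by simp

lemma abs_integrable_subinterval:
  fixes g :: "real \<Rightarrow> real"
  assumes "g absolutely_integrable_on {a..b}" "a \<le> s" "t \<le> b"
  shows "g integrable_on {s..t}" "(\<lambda>x. \<bar>g x\<bar>) integrable_on {s..t}"
proof -
  have "{s..t} \<subseteq> {a..b}" using assms(2,3) by auto
  moreover have "g integrable_on {a..b}" "(\<lambda>x. \<bar>g x\<bar>) integrable_on {a..b}"
    using assms(1) by (auto simp: absolutely_integrable_on_def)
  ultimately show "g integrable_on {s..t}" "(\<lambda>x. \<bar>g x\<bar>) integrable_on {s..t}"
    using integrable_on_subinterval by blast+
qed

text \<open>The function \<open>F\<close> below is continuous and an L1-limit of constants, hence constant.\<close>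
lemma W11_deriv_increment:
  assumes ab: "a < b" and cont: "continuous_on {a..b} f" and W: "W11_deriv {a..b} f g"
    and st: "a \<le> s" "s \<le> t" "t \<le> b"
  shows "f t - f s = integral {s..t} g"
proof -
  have g: "g absolutely_integrable_on {a..b}" using W by (simp add: W11_deriv_def)
  obtain u u' where C1: "\<And>n. C1_with_deriv {a..b} (u n) (u' n)"
    and lim: "(\<lambda>n. integral {a..b} (\<lambda>t. \<bar>u n t - f t\<bar>) + integral {a..b} (\<lambda>t. \<bar>u' n t - g t\<bar>)) \<longlonglongrightarrow> 0"
    using W unfolding W11_deriv_def by blast
  define G where "G = (\<lambda>t. integral {a..t} g)"
  define F where "F = (\<lambda>t. f t - G t)"
  \<comment> \<open>The approximations suggest the constant \<open>u n a\<close>, which varies with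
    \<open>n\<close>. The mean of \<open>F\<close> is fixed, and replacing \<open>u n a\<close> by
    it at most doubles the L1 distance to \<open>F\<close>.\<close>
  define A where "A = integral {a..b} F / (b - a)"
  define eps where "eps = (\<lambda>n. integral {a..b} (\<lambda>t. \<bar>u n t - f t\<bar>) + integral {a..b} (\<lambda>t. \<bar>u' n t - g t\<bar>))"
  have cG: "continuous_on {a..b} G" unfolding G_def
    using abs_integrable_subinterval[OF g] by (intro indefinite_integral_continuous_1) auto
  have cF: "continuous_on {a..b} F" unfolding F_def by (intro continuous_intros cont cG)
  have cu: "continuous_on {a..b} (u n)" "continuous_on {a..b} (u' n)" for n
    using C1[of n] unfolding C1_with_deriv_def
    by (auto intro!: DERIV_continuous_on)
  have abs_u: "(\<lambda>t. u' n t - g t) absolutely_integrable_on {a..b}" for n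
    using absolutely_integrable_continuous_real[OF cu(2)] g by (rule set_integral_diff(1))
  have bound: "integral {a..b} (\<lambda>t. \<bar>F t - A\<bar>) \<le> (2 + 2 * (b - a)) * eps n" for n
  proof -
    define E1 where "E1 = integral {a..b} (\<lambda>t. \<bar>u n t - f t\<bar>)"
    define E2 where "E2 = integral {a..b} (\<lambda>t. \<bar>u' n t - g t\<bar>)"
    let ?c = "u n a"
    have nonneg: "E1 \<ge> 0" "E2 \<ge> 0" unfolding E1_def E2_def
      using abs_integrable_subinterval(2)[OF abs_u, of a b n]
      by (auto intro!: integral_nonneg[of "\<lambda>t. \<bar>u n t - f t\<bar>"] integral_nonneg[of "\<lambda>t. \<bar>u' n t - g t\<bar>"]
          integrable_continuous_real[of _ _ "\<lambda>t. \<bar>u n t - f t\<bar>"] continuous_intros cu cont)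
    \<comment> \<open>\<open>F t - ?c\<close> is \<open>f t - u n t\<close> plus the integral of
      \<open>u' n - g\<close> over \<open>{a..t}\<close>, by the fundamental theorem for
      \<open>u n\<close>.\<close>
    have pt: "\<bar>F t - ?c\<bar> \<le> \<bar>u n t - f t\<bar> + E2" if t: "t \<in> {a..b}" for t
    proof -
      have "(u' n has_integral (u n t - ?c)) {a..t}"
      proof (rule fundamental_theorem_of_calculus)
        fix x assume "x \<in> {a..t}"
        then have "(u n has_real_derivative u' n x) (at x within {a..b})"
          using C1[of n] t by (auto simp: C1_with_deriv_def)
        then have "(u n has_real_derivative u' n x) (at x within {a..t})"
          using t by (elim has_field_derivative_subset) auto
        then show "(u n has_vector_derivative u' n x) (at x within {a..t})"
          by (simp add: has_real_derivative_iff_has_vector_derivative)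
      qed (use t in auto)
      moreover have "(g has_integral G t) {a..t}" unfolding G_def
        using abs_integrable_subinterval(1)[OF g, of a t] t by auto
      ultimately have "((\<lambda>x. u' n x - g x) has_integral (u n t - ?c - G t)) {a..t}"
        by (rule has_integral_diff)
      then have "\<bar>u n t - ?c - G t\<bar> = \<bar>integral {a..t} (\<lambda>x. u' n x - g x)\<bar>"
        by (simp add: integral_unique)
      also have "\<dots> \<le> integral {a..t} (\<lambda>x. \<bar>u' n x - g x\<bar>)"
        using abs_integrable_subinterval[OF abs_u, of a t] t
        by (intro abs_integral_le) auto
      also have "\<dots> \<le> E2" unfolding E2_def
        using abs_integrable_subinterval(2)[OF abs_u] t by (intro integral_subset_le) auto
      finally show ?thesis by (simp add: F_def)
    qed
    have int1: "integral {a..b} (\<lambda>t. \<bar>F t - ?c\<bar>) \<le> E1 + (b - a) * E2"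
    proof -
      have "integral {a..b} (\<lambda>t. \<bar>F t - ?c\<bar>) \<le> integral {a..b} (\<lambda>t. \<bar>u n t - f t\<bar> + E2)"
        by (intro integral_le integrable_continuous_real continuous_intros cF cu cont pt)
      also have "\<dots> = E1 + integral {a..b} (\<lambda>t. E2)" unfolding E1_def
        by (intro integral_add integrable_continuous_real continuous_intros cu cont)
      finally show ?thesis using ab by simp
    qed
    have "integral {a..b} (\<lambda>t. F t - ?c) = integral {a..b} F - integral {a..b} (\<lambda>t. ?c)"
      by (intro integral_diff integrable_continuous_real continuous_intros cF)
    moreover have "(b - a) * A = integral {a..b} F" using ab by (simp add: A_def)
    ultimately have "(b - a) * (A - ?c) = integral {a..b} (\<lambda>t. F t - ?c)"
      using ab by (simp add: right_diff_distrib)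
    then have "(b - a) * \<bar>A - ?c\<bar> = \<bar>integral {a..b} (\<lambda>t. F t - ?c)\<bar>"
      using ab by (metis abs_mult abs_of_pos diff_gt_0_iff_gt)
    also have "\<dots> \<le> integral {a..b} (\<lambda>t. \<bar>F t - ?c\<bar>)"
      by (intro abs_integral_le integrable_continuous_real continuous_intros cF) auto
    finally have A: "(b - a) * \<bar>A - ?c\<bar> \<le> integral {a..b} (\<lambda>t. \<bar>F t - ?c\<bar>)" .
    have "integral {a..b} (\<lambda>t. \<bar>F t - A\<bar>) \<le> integral {a..b} (\<lambda>t. \<bar>F t - ?c\<bar> + \<bar>A - ?c\<bar>)"
      by (intro integral_le integrable_continuous_real continuous_intros cF) auto
    also have "\<dots> = integral {a..b} (\<lambda>t. \<bar>F t - ?c\<bar>) + integral {a..b} (\<lambda>t. \<bar>A - ?c\<bar>)"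
      by (intro integral_add integrable_continuous_real continuous_intros cF)
    also have "\<dots> \<le> 2 * (E1 + (b - a) * E2)" using A int1 ab by simp
    also have "\<dots> \<le> (2 + 2 * (b - a)) * (E1 + E2)"
      using nonneg mult_nonneg_nonneg[of "b - a" E1] ab by (simp add: algebra_simps)
    finally show ?thesis by (simp add: eps_def E1_def E2_def)
  qed
  have "(\<lambda>n. (2 + 2 * (b - a)) * eps n) \<longlonglongrightarrow> (2 + 2 * (b - a)) * 0"
    using lim unfolding eps_def by (intro tendsto_mult tendsto_const)
  then have "integral {a..b} (\<lambda>t. \<bar>F t - A\<bar>) \<le> 0"
    using bound by (intro LIMSEQ_le_const) auto
  moreover have cA: "continuous_on {a..b} (\<lambda>t. \<bar>F t - A\<bar>)" by (intro continuous_intros cF)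
  moreover have "integral {a..b} (\<lambda>t. \<bar>F t - A\<bar>) \<ge> 0"
    by (intro integral_nonneg integrable_continuous_real cA) auto
  ultimately have "((\<lambda>t. \<bar>F t - A\<bar>) has_integral 0) (cbox a b)"
    using integrable_integral[OF integrable_continuous_real[OF cA]] by simp
  then have "\<bar>F r - A\<bar> = 0" if "r \<in> {a..b}" for r
    using has_integral_0_cbox_imp_0[of a b "\<lambda>t. \<bar>F t - A\<bar>" r] cA ab that by auto
  from this[of s] this[of t] have "F s = F t" using st by simp
  moreover have "G s + integral {s..t} g = G t" unfolding G_def
    using st abs_integrable_subinterval(1)[OF g] by (intro Henstock_Kurzweil_Integration.integral_combine) auto
  ultimately show ?thesis by (simp add: F_def)
qed

text \<open>The primitive of \<open>\<bar>g\<bar>\<close> serves as a variation function: the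
  estimates for sums below use the weak derivative only through the increments of such a function
  \<open>W\<close>.\<close>

lemma W11_deriv_increment_le:
  assumes "a < b" "continuous_on {a..b} f" "W11_deriv {a..b} f g" "a \<le> s" "s \<le> t" "t \<le> b"
  shows "\<bar>f t - f s\<bar> \<le> integral {a..t} (\<lambda>x. \<bar>g x\<bar>) - integral {a..s} (\<lambda>x. \<bar>g x\<bar>)"
proof -
  have g: "g absolutely_integrable_on {a..b}" using assms(3) by (simp add: W11_deriv_def)
  have "\<bar>f t - f s\<bar> \<le> integral {s..t} (\<lambda>x. \<bar>g x\<bar>)"
    unfolding W11_deriv_increment[OF assms] using abs_integrable_subinterval[OF g, of s t] assms
    by (intro abs_integral_le) auto
  moreover have "integral {a..s} (\<lambda>x. \<bar>g x\<bar>) + integral {s..t} (\<lambda>x. \<bar>g x\<bar>) = integral {a..t} (\<lambda>x. \<bar>g x\<bar>)"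
    using assms abs_integrable_subinterval(2)[OF g] by (intro Henstock_Kurzweil_Integration.integral_combine) auto
  ultimately show ?thesis by simp
qed

section \<open>Comparison of sums over a progression with integrals\<close>

lemma integral_minus_point_value_le:
  fixes f W :: "real \<Rightarrow> real"
  assumes cont: "continuous_on {c..d} f" and s: "c \<le> s" "s \<le> d"
    and var: "\<And>s t. c \<le> s \<Longrightarrow> s \<le> t \<Longrightarrow> t \<le> d \<Longrightarrow> \<bar>f t - f s\<bar> \<le> W t - W s"
  shows "\<bar>(d - c) * f s - integral {c..d} f\<bar> \<le> (d - c) * (W d - W c)"
proof -
  have pt: "\<bar>f s - f t\<bar> \<le> W d - W c" if t: "t \<in> {c..d}" for t
    using var[of s t] var[of t s] var[of c "min s t"] var[of "max s t" d] s t
    by (cases "s \<le> t") auto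
  have "(d - c) * f s - integral {c..d} f = integral {c..d} (\<lambda>t. f s - f t)"
    using s by (subst integral_diff) (auto intro!: integrable_continuous_real cont)
  also have "\<bar>\<dots>\<bar> \<le> integral {c..d} (\<lambda>t. W d - W c)"
    using pt by (intro abs_integral_le integrable_continuous_real continuous_intros cont)
  finally show ?thesis using s by simp
qed

text \<open>Each cell contributes at most \<open>q\<close> times the increment of \<open>W\<close>
  over it, and the increments telescope. The points \<open>s i\<close> are free within their cells,
  so left and right end points are both available.\<close>

lemma riemann_sum_error:
  fixes f W :: "real \<Rightarrow> real"
  assumes cont: "continuous_on {a..b} f"
    and var: "\<And>s t. a \<le> s \<Longrightarrow> s \<le> t \<Longrightarrow> t \<le> b \<Longrightarrow> \<bar>f t - f s\<bar> \<le> W t - W s"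
    and q: "q \<ge> 0" and c: "a \<le> c" "c + real m * q \<le> b"
    and s: "\<And>i. c + real i * q \<le> s i \<and> s i \<le> c + real (Suc i) * q"
  shows "\<bar>(\<Sum>i<m. q * f (s i)) - integral {c..c + real m * q} f\<bar> \<le> q * (W (c + real m * q) - W c)"
  using c(2)
proof (induction m)
  case (Suc m)
  let ?e = "c + real m * q" and ?e' = "c + real (Suc m) * q"
  have ee: "?e' - ?e = q" by (simp add: algebra_simps)
  have le: "c \<le> ?e" "?e \<le> ?e'" using q by (auto simp: algebra_simps)
  then have IH: "\<bar>(\<Sum>i<m. q * f (s i)) - integral {c..?e} f\<bar> \<le> q * (W ?e - W c)"
    using Suc by (intro Suc.IH) simp
  have sub: "continuous_on {c'..d'} f" if "a \<le> c'" "d' \<le> b" for c' d'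
    using cont by (rule continuous_on_subset) (use that in auto)
  have "\<bar>(?e' - ?e) * f (s m) - integral {?e..?e'} f\<bar> \<le> (?e' - ?e) * (W ?e' - W ?e)"
    using s[of m] c(1) le Suc.prems
    by (intro integral_minus_point_value_le sub var) linarith+
  then have "\<bar>q * f (s m) - integral {?e..?e'} f\<bar> \<le> q * (W ?e' - W ?e)" by (simp only: ee)
  moreover have "integral {c..?e} f + integral {?e..?e'} f = integral {c..?e'} f"
    by (rule Henstock_Kurzweil_Integration.integral_combine) (use c(1) le Suc.prems in \<open>auto intro!: integrable_continuous_real sub\<close>)
  ultimately show ?case using IH by (simp add: algebra_simps abs_le_iff)
qed simp

text \<open>The terms cut out full cells of length \<open>q\<close> and leave a piece of length at
  most \<open>q\<close> at each end. A single \<open>B\<close> suffices: for the upper bound it pays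
  for the one term in excess of the cells, and for the lower bound it pays for the last piece, while
  the first term pays for the first piece up to variation.\<close>

lemma sum_arithmetic_progression_error:
  fixes f W :: "real \<Rightarrow> real" and q r :: nat
  assumes ab: "0 \<le> a" "a \<le> b" and cont: "continuous_on {a..b} f"
    and f: "\<And>t. a \<le> t \<Longrightarrow> t \<le> b \<Longrightarrow> 0 \<le> f t \<and> f t \<le> B"
    and var: "\<And>s t. a \<le> s \<Longrightarrow> s \<le> t \<Longrightarrow> t \<le> b \<Longrightarrow> \<bar>f t - f s\<bar> \<le> W t - W s"
    and q: "q > 0"
  shows "\<bar>(\<Sum>n | real n \<in> {a..b} \<and> [n = r] (mod q). f (real n)) - integral {a..b} f / real q\<bar>
      \<le> B + (W b - W a)"
proof -
  let ?P = "{n. real n \<in> {a..b} \<and> [n = r] (mod q)}"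
  have sub: "continuous_on {c..d} f" if "a \<le> c" "d \<le> b" for c d
    using cont by (rule continuous_on_subset) (use that in auto)
  have int_nonneg: "integral {c..d} f \<ge> 0" if "a \<le> c" "d \<le> b" for c d
    using that f by (intro integral_nonneg integrable_continuous_real sub) auto
  have int_le: "integral {c..d} f \<le> real q * B" if "a \<le> c" "c \<le> d" "d \<le> b" "d - c \<le> real q" for c d
  proof -
    have "integral {c..d} f \<le> integral {c..d} (\<lambda>_. B)"
      using that f by (intro integral_le integrable_continuous_real sub continuous_intros) auto
    also have "\<dots> = (d - c) * B" using that by simp
    also have "\<dots> \<le> real q * B" using that f[of c] by (intro mult_right_mono) auto
    finally show ?thesis .
  qed
  define n0 where "n0 = (LEAST n. a \<le> real n \<and> [n = r] (mod q))"
  have "\<exists>n. a \<le> real n \<and> [n = r] (mod q)"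
  proof -
    obtain j :: nat where "a \<le> real j" using real_arch_simple by blast
    moreover have "real j \<le> real (r + q * j)" using q by (simp add: mult_le_cancel_right1 add_increasing)
    ultimately have "a \<le> real (r + q * j)" by linarith
    then show ?thesis by (intro exI[of _ "r + q * j"]) (simp add: cong_def)
  qed
  then have n0: "a \<le> real n0" "[n0 = r] (mod q)"
    unfolding n0_def by (metis (mono_tags, lifting) LeastI_ex)+
  have least: "n0 \<le> n" if "a \<le> real n" "[n = r] (mod q)" for n
    unfolding n0_def using that by (intro Least_le) simp
  \<comment> \<open>Otherwise \<open>n0 - q\<close> would be an earlier term; it is a natural number
    because \<open>0 \<le> a\<close>.\<close>
  have n0_le: "real n0 \<le> a + real q"
  proof (rule ccontr)
    assume *: "\<not> real n0 \<le> a + real q"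
    then have "n0 \<ge> q" using ab by linarith
    then obtain n where n: "n0 = n + q" using le_Suc_ex add.commute by metis
    then have "[n = r] (mod q)" using n0(2) by (simp add: cong_def)
    moreover have "a \<le> real n" using * n by simp
    ultimately show False using least[of n] n q by simp
  qed
  show ?thesis
  proof (cases "real n0 \<le> b")
    \<comment> \<open>There is no term in the interval, and \<open>b < n0 <= a + q\<close>, so the
      integral is at most \<open>q * B\<close>.\<close>
    case False
    then have "?P = {}" using least by force
    then have "(\<Sum>n\<in>?P. f (real n)) = 0" by (simp only: sum.empty)
    moreover have "integral {a..b} f / real q \<le> B"
      using int_le[of a b] False n0_le ab q by (simp add: divide_le_eq mult.commute)
    moreover have "0 \<le> W b - W a" using var[of a b] ab by linarith
    moreover have "integral {a..b} f / real q \<ge> 0" using int_nonneg[of a b] by simp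
    ultimately show ?thesis by linarith
  next
    case True
    define m where "m = nat \<lfloor>(b - real n0) / real q\<rfloor>"
    define c where "c = real n0"
    define e where "e = c + real m * real q"
    have m1: "real m \<le> (b - c) / real q" "(b - c) / real q < real m + 1"
      using True q unfolding m_def c_def by (auto simp: of_nat_nat)
    have e: "c \<le> e" "e \<le> b" "b - e \<le> real q" "a \<le> c" "c - a \<le> real q"
      using m1 q n0(1) n0_le unfolding e_def by (auto simp: field_simps c_def)
    have P: "?P = (\<lambda>i. n0 + i * q) ` {..m}"
    proof (intro equalityI subsetI)
      fix n assume n: "n \<in> ?P"
      then have "n0 \<le> n" "[n = n0] (mod q)" using least n0(2) by (auto intro: cong_trans cong_sym)
      then obtain i where i: "n = n0 + i * q"
        by (metis cong_le_nat mult.commute add.commute cong_sym)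
      then have "real i \<le> (b - c) / real q" using n q by (simp add: c_def field_simps)
      then have "real i < real m + 1" using m1 by linarith
      then show "n \<in> (\<lambda>i. n0 + i * q) ` {..m}" using i by auto
    next
      fix n assume "n \<in> (\<lambda>i. n0 + i * q) ` {..m}"
      then obtain i where i: "n = n0 + i * q" "i \<le> m" by auto
      have "real i * real q \<le> real m * real q" using i(2) by (intro mult_right_mono) auto
      then have "real n \<le> b" using e i(1) by (simp add: e_def c_def)
      moreover have "a \<le> real n" using n0(1) i by (simp add: add_increasing2)
      moreover have "[n = r] (mod q)" using n0(2) i by (simp add: cong_def)
      ultimately show "n \<in> ?P" by simp
    qed
    have inj: "inj_on (\<lambda>i. n0 + i * q) {..m}" using q by (auto intro: inj_onI)
    have "(\<Sum>n\<in>?P. f (real n)) = (\<Sum>i\<le>m. f (c + real i * real q))"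
      unfolding P by (subst sum.reindex[OF inj]) (simp add: c_def)
    then have S: "real q * (\<Sum>n\<in>?P. f (real n)) = (\<Sum>i\<le>m. real q * f (c + real i * real q))"
      by (simp add: sum_distrib_left)
    \<comment> \<open>Left end points: the omitted term \<open>f e\<close> is at most
      \<open>B\<close>. This serves the upper bound.\<close>
    have up: "\<bar>(\<Sum>i<m. real q * f (c + real i * real q)) - integral {c..e} f\<bar> \<le> real q * (W e - W c)"
      unfolding e_def
      by (rule riemann_sum_error[OF cont var]) (use e in \<open>auto simp: e_def algebra_simps\<close>)
    \<comment> \<open>Right end points: the omitted term \<open>f c\<close> is kept to cover the
      integral over \<open>{a..c}\<close>. This serves the lower bound.\<close>
    have lo: "\<bar>(\<Sum>i<m. real q * f (c + real (Suc i) * real q)) - integral {c..e} f\<bar> \<le> real q * (W e - W c)"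
      unfolding e_def
      by (rule riemann_sum_error[OF cont var]) (use e in \<open>auto simp: e_def algebra_simps\<close>)
    have split: "integral {a..b} f = integral {a..c} f + integral {c..e} f + integral {e..b} f"
      using e Henstock_Kurzweil_Integration.integral_combine[of a c e f] Henstock_Kurzweil_Integration.integral_combine[of a e b f]
      by (simp add: integrable_continuous_real sub)
    have Wm: "W c - W a \<ge> 0" "W b - W e \<ge> 0" "W e - W c \<ge> 0"
      using var[of a c] var[of e b] var[of c e] e by linarith+
    have first: "integral {a..c} f \<le> real q * f c + real q * (W c - W a)"
    proof -
      have "\<bar>(c - a) * f c - integral {a..c} f\<bar> \<le> (c - a) * (W c - W a)"
        using e by (intro integral_minus_point_value_le sub var) auto
      moreover have "(c - a) * f c \<le> real q * f c" "(c - a) * (W c - W a) \<le> real q * (W c - W a)"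
        using e f[of c] Wm by (auto intro!: mult_right_mono)
      ultimately show ?thesis by linarith
    qed
    have last: "integral {e..b} f \<le> real q * B" using e by (intro int_le) auto
    have B: "real q * f e \<le> real q * B" using f[of e] e by (intro mult_left_mono) auto
    have W1: "real q * (W c - W a) \<ge> 0" "real q * (W b - W e) \<ge> 0" using Wm by auto
    have Wsum: "real q * (W b - W a) = real q * (W c - W a) + real q * (W e - W c) + real q * (W b - W e)"
      by (simp add: algebra_simps)
    have S1: "(\<Sum>i\<le>m. real q * f (c + real i * real q))
        = (\<Sum>i<m. real q * f (c + real i * real q)) + real q * f e"
      by (simp add: lessThan_Suc_atMost[symmetric] e_def)
    have S2: "(\<Sum>i\<le>m. real q * f (c + real i * real q))
        = real q * f c + (\<Sum>i<m. real q * f (c + real (Suc i) * real q))"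
      by (simp add: sum.atMost_shift)
    have "real q * (\<Sum>n\<in>?P. f (real n)) - integral {a..b} f \<le> real q * (B + (W b - W a))"
      using up S S1 split B W1 Wsum int_nonneg[of a c] int_nonneg[of e b] e
      by (simp add: distrib_left)
    moreover have "integral {a..b} f - real q * (\<Sum>n\<in>?P. f (real n)) \<le> real q * (B + (W b - W a))"
      using lo S S2 split first last W1 Wsum by (simp add: distrib_left)
    ultimately have "\<bar>real q * (\<Sum>n\<in>?P. f (real n)) - integral {a..b} f\<bar> \<le> real q * (B + (W b - W a))"
      by linarith
    moreover have "real q * (\<Sum>n\<in>?P. f (real n)) - integral {a..b} f
        = real q * ((\<Sum>n\<in>?P. f (real n)) - integral {a..b} f / real q)"
      using q by (simp add: field_simps)
    ultimately show ?thesis using q by (simp add: abs_mult)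
  qed
qed

section \<open>The sieve bound\<close>

text \<open>For a prime above \<open>N\<close> the only divisor in the support is 1, so its squared
  weight sum is 1; for other numbers the square is nonnegative. Expanding the square turns pairs
  \<open>d\<close>, \<open>e\<close> into the modulus \<open>lcm d e\<close>: the main terms add up
  to \<open>selberg_weight_form\<close> and the errors to the squared sum of absolute weights. The
  \<open>N\<close> possible primes up to \<open>N\<close> cost at most \<open>E\<close>
  each.\<close>

lemma selberg_sieve:
  fixes f :: "nat \<Rightarrow> real"
  assumes P: "finite P" and f: "\<And>n. n \<in> P \<Longrightarrow> 0 \<le> f n \<and> f n \<le> E"
    and dens: "\<And>d. d > 0 \<Longrightarrow> coprime d k \<Longrightarrow> \<bar>(\<Sum>n | n \<in> P \<and> d dvd n. f n) - Y / real d\<bar> \<le> E"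
    and E: "E \<ge> 0" and N: "N \<ge> 1"
  shows "(\<Sum>p | p \<in> P \<and> prime p. f p)
    \<le> Y / sieve_mass k N + E * ((\<Sum>d\<in>sieve_support k N. \<bar>selberg_weight k N d\<bar>)\<^sup>2 + real N)"
proof -
  let ?D = "sieve_support k N" and ?w = "selberg_weight k N"
  have small: "(\<Sum>p | p \<in> P \<and> prime p \<and> p \<le> N. f p) \<le> real N * E"
  proof -
    have "card {p. p \<in> P \<and> prime p \<and> p \<le> N} \<le> card {1..N}"
      by (intro card_mono) (auto dest: prime_ge_1_nat)
    then have "real (card {p. p \<in> P \<and> prime p \<and> p \<le> N}) * E \<le> real N * E"
      using E by (intro mult_right_mono) auto
    moreover have "(\<Sum>p | p \<in> P \<and> prime p \<and> p \<le> N. f p) \<le> real (card {p. p \<in> P \<and> prime p \<and> p \<le> N}) * E"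
      using f by (intro sum_bounded_above) auto
    ultimately show ?thesis by linarith
  qed
  have one: "(\<Sum>d\<in>?D. if d dvd p then ?w d else 0) = 1" if "prime p" "p > N" for p
  proof -
    have "(\<Sum>d\<in>?D. if d dvd p then ?w d else 0) = (\<Sum>d\<in>?D. if d = 1 then ?w d else 0)"
    proof (rule sum.cong)
      fix d assume "d \<in> ?D"
      then have "d \<noteq> p" using that by (auto simp: sieve_support_def)
      then show "(if d dvd p then ?w d else 0) = (if d = 1 then ?w d else 0)"
        using that(1) by (auto simp: prime_nat_iff)
    qed simp
    then show ?thesis using one_in_sieve_support[OF N] selberg_weight_1[OF N, of k] by simp
  qed
  have "(\<Sum>p | p \<in> P \<and> prime p \<and> N < p. f p)
      = (\<Sum>p | p \<in> P \<and> prime p \<and> N < p. f p * (\<Sum>d\<in>?D. if d dvd p then ?w d else 0)\<^sup>2)"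
    using one by (intro sum.cong refl) auto
  also have "\<dots> \<le> (\<Sum>n\<in>P. f n * (\<Sum>d\<in>?D. if d dvd n then ?w d else 0)\<^sup>2)"
    using f P by (intro sum_mono2) auto
  also have "\<dots> = (\<Sum>n\<in>P. \<Sum>d\<in>?D. \<Sum>e\<in>?D. ?w d * ?w e * (if lcm d e dvd n then f n else 0))"
    unfolding power2_eq_square sum_product unfolding sum_distrib_left
    by (intro sum.cong refl) auto
  also have "\<dots> = (\<Sum>d\<in>?D. \<Sum>e\<in>?D. \<Sum>n\<in>P. ?w d * ?w e * (if lcm d e dvd n then f n else 0))"
    by (subst sum.swap, rule sum.cong[OF refl], rule sum.swap)
  also have "\<dots> = (\<Sum>d\<in>?D. \<Sum>e\<in>?D. ?w d * ?w e * (\<Sum>n | n \<in> P \<and> lcm d e dvd n. f n))"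
    using P by (simp add: sum_distrib_left[symmetric] sum.inter_filter[symmetric])
  also have "\<dots> \<le> (\<Sum>d\<in>?D. \<Sum>e\<in>?D. Y * (?w d * ?w e / real (lcm d e)) + E * (\<bar>?w d\<bar> * \<bar>?w e\<bar>))"
  proof (intro sum_mono)
    fix d e assume de: "d \<in> ?D" "e \<in> ?D"
    let ?S = "\<Sum>n | n \<in> P \<and> lcm d e dvd n. f n"
    have "lcm d e > 0" using de sieve_support_pos by (simp add: lcm_pos_nat)
    moreover have "coprime (lcm d e) k"
    proof -
      have "coprime (d * e) k" using de by (simp add: sieve_support_def)
      then show ?thesis by (rule coprime_divisors[rotated 2]) (simp_all add: lcm_least)
    qed
    ultimately have "\<bar>?S - Y / real (lcm d e)\<bar> \<le> E" by (rule dens)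
    then have "\<bar>?w d * ?w e\<bar> * \<bar>?S - Y / real (lcm d e)\<bar> \<le> \<bar>?w d * ?w e\<bar> * E"
      by (intro mult_left_mono) auto
    moreover have "?w d * ?w e * (?S - Y / real (lcm d e)) \<le> \<bar>?w d * ?w e\<bar> * \<bar>?S - Y / real (lcm d e)\<bar>"
      unfolding abs_mult[symmetric] by (rule abs_ge_self)
    ultimately have "?w d * ?w e * (?S - Y / real (lcm d e)) \<le> E * (\<bar>?w d\<bar> * \<bar>?w e\<bar>)"
      by (simp only: abs_mult mult.commute[of E])
    then show "?w d * ?w e * ?S \<le> Y * (?w d * ?w e / real (lcm d e)) + E * (\<bar>?w d\<bar> * \<bar>?w e\<bar>)"
      by (simp add: algebra_simps)
  qed
  also have "\<dots> = Y * (\<Sum>d\<in>?D. \<Sum>e\<in>?D. ?w d * ?w e / real (lcm d e)) + E * (\<Sum>d\<in>?D. \<bar>?w d\<bar>)\<^sup>2"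
    by (simp only: sum.distrib sum_distrib_left[symmetric] power2_eq_square sum_product)
  also have "\<dots> = Y / sieve_mass k N + E * (\<Sum>d\<in>?D. \<bar>?w d\<bar>)\<^sup>2"
    using selberg_weight_form[OF N, of k] by simp
  finally have large: "(\<Sum>p | p \<in> P \<and> prime p \<and> N < p. f p) \<le> \<dots>" .
  have "{p. p \<in> P \<and> prime p} = {p. p \<in> P \<and> prime p \<and> p \<le> N} \<union> {p. p \<in> P \<and> prime p \<and> N < p}" by auto
  then have "(\<Sum>p | p \<in> P \<and> prime p. f p)
      = (\<Sum>p | p \<in> P \<and> prime p \<and> p \<le> N. f p) + (\<Sum>p | p \<in> P \<and> prime p \<and> N < p. f p)"
    by (simp only:, intro sum.union_disjoint) (use P in auto)
  then show ?thesis using small large by (simp add: algebra_simps)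
qed

text \<open>Chinese remainder theorem. This is where the sieve needs its moduli coprime to
  \<open>k\<close>.\<close>

lemma residue_class_dvd:
  fixes l k d :: nat
  assumes "coprime d k"
  obtains r where "\<And>n. [n = l] (mod k) \<and> d dvd n \<longleftrightarrow> [n = r] (mod (k * d))"
proof -
  from assms have kd: "coprime k d" by (simp add: coprime_commute)
  obtain r where r: "[r = l] (mod k)" "[r = 0] (mod d)"
    using binary_chinese_remainder_nat[OF kd, of l 0] by blast
  show thesis
  proof (rule that[of r], rule iffI)
    fix n assume "[n = l] (mod k) \<and> d dvd n"
    then have "[n = r] (mod k)" "[n = r] (mod d)"
      using r by (auto simp: cong_def mod_eq_0_iff_dvd)
    then show "[n = r] (mod (k * d))" using kd by (rule coprime_cong_mult_nat)
  next
    fix n assume "[n = r] (mod (k * d))"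
    then have "[n = r] (mod k)" "[n = r] (mod d)"
      using cong_dvd_modulus_nat[of n r "k * d" k] cong_dvd_modulus_nat[of n r "k * d" d] by simp_all
    then show "[n = l] (mod k) \<and> d dvd n" using r by (auto simp: cong_def mod_eq_0_iff_dvd)
  qed
qed

text \<open>Within the class of \<open>l\<close>, the multiples of \<open>d\<close> form one class
  modulo \<open>k * d\<close>. So the sieve applies with \<open>Y = norm1 I f / k\<close> and with
  the same error for every \<open>d\<close>.\<close>

lemma prime_sum_sieve_bound:
  fixes x y :: real and l k :: nat
  assumes xy: "x \<ge> 0" "y > 0" and k: "k \<ge> 1" "coprime l k"
    and W: "W11 {x..x+y} f" and pos: "\<forall>t\<in>{x..x+y}. f t \<ge> 0" and N: "N \<ge> 1"
  shows "(\<Sum>p | prime p \<and> real p \<in> {x..x+y} \<and> [p = l] (mod k). f (real p))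
    \<le> norm1 {x..x+y} f / (real k * sieve_mass k N)
      + (norm_inf {x..x+y} f + deriv_norm1 {x..x+y} f)
        * ((\<Sum>d\<in>sieve_support k N. \<bar>selberg_weight k N d\<bar>)\<^sup>2 + real N)"
proof -
  let ?I = "{x..x+y}"
  \<comment> \<open>The same choice as in \<open>deriv_norm1\<close>, so that the total variation
    bound is exactly that quantity.\<close>
  define g where "g = (SOME g. W11_deriv ?I f g)"
  define V where "V = (\<lambda>t. integral {x..t} (\<lambda>s. \<bar>g s\<bar>))"
  have cont: "continuous_on ?I f" and ex: "\<exists>g. W11_deriv ?I f g" using W by (simp_all add: W11_def)
  have g: "W11_deriv ?I f g" unfolding g_def by (rule someI_ex[OF ex])
  have var: "\<bar>f t - f s\<bar> \<le> V t - V s" if "x \<le> s" "s \<le> t" "t \<le> x + y" for s t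
    unfolding V_def by (rule W11_deriv_increment_le[OF _ cont g]) (use xy that in auto)
  have V: "V (x + y) - V x = deriv_norm1 ?I f"
    by (simp add: V_def deriv_norm1_def norm1_def g_def)
  have Vpos: "deriv_norm1 ?I f \<ge> 0" using var[of x "x + y"] xy V by linarith
  have "bdd_above ((\<lambda>t. \<bar>f t\<bar>) ` ?I)"
    by (intro bounded_imp_bdd_above compact_imp_bounded compact_continuous_image continuous_intros cont) auto
  then have sup: "f t \<le> norm_inf ?I f" if "t \<in> ?I" for t
    unfolding norm_inf_def using cSUP_upper[OF that, of "\<lambda>t. \<bar>f t\<bar>"] by linarith
  have sup0: "norm_inf ?I f \<ge> 0" 
  proof -
    have "x \<in> ?I" using xy by simp
    then show ?thesis using sup pos order_trans by blast
  qed
  have int: "integral ?I f = norm1 ?I f"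
    unfolding norm1_def by (intro Henstock_Kurzweil_Integration.integral_cong) (use pos in auto)
  define P where "P = {n. real n \<in> ?I \<and> [n = l] (mod k)}"
  have "finite P" by (rule finite_subset[of _ "{..nat \<lceil>x + y\<rceil>}"]) (auto simp: P_def, linarith)
  then have "(\<Sum>p | p \<in> P \<and> prime p. f (real p))
    \<le> (norm1 ?I f / real k) / sieve_mass k N + (norm_inf ?I f + deriv_norm1 ?I f)
        * ((\<Sum>d\<in>sieve_support k N. \<bar>selberg_weight k N d\<bar>)\<^sup>2 + real N)"
  proof (rule selberg_sieve[OF _ _ _ _ N])
    show "0 \<le> f (real n) \<and> f (real n) \<le> norm_inf ?I f + deriv_norm1 ?I f" if "n \<in> P" for n
      using that sup[of "real n"] pos Vpos by (auto simp: P_def intro: add_increasing2)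
    show "0 \<le> norm_inf ?I f + deriv_norm1 ?I f" using sup0 Vpos by simp
    fix d :: nat assume d: "d > 0" "coprime d k"
    obtain r where r: "\<And>n. [n = l] (mod k) \<and> d dvd n \<longleftrightarrow> [n = r] (mod (k * d))"
      using residue_class_dvd[OF d(2), of l] by blast
    have "{n. n \<in> P \<and> d dvd n} = {n. real n \<in> ?I \<and> [n = r] (mod (k * d))}"
      using r by (auto simp: P_def)
    moreover have "\<bar>(\<Sum>n | real n \<in> ?I \<and> [n = r] (mod (k * d)). f (real n)) - integral ?I f / real (k * d)\<bar>
        \<le> norm_inf ?I f + (V (x + y) - V x)"
      using xy k d pos sup
      by (intro sum_arithmetic_progression_error cont var) auto
    ultimately show "\<bar>(\<Sum>n | n \<in> P \<and> d dvd n. f (real n)) - norm1 ?I f / real k / real d\<bar>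
        \<le> norm_inf ?I f + deriv_norm1 ?I f"
      by (simp only: V int) simp
  qed
  moreover have "{p. p \<in> P \<and> prime p} = {p. prime p \<and> real p \<in> ?I \<and> [p = l] (mod k)}"
    by (auto simp: P_def)
  ultimately show ?thesis by simp
qed

section \<open>Choice of the sieve level\<close>

text \<open>The base is the quadratic Taylor value \<open>1 + 1/5 + 1/50\<close> at 1/5. It reduces
  estimates of \<open>exp\<close> at multiples of 1/5 to rational arithmetic.\<close>

lemma exp_ge_power: "exp (real n / 5) \<ge> (122 / 100) ^ n"
proof -
  have "(122 / 100 :: real) \<le> exp (1 / 5)"
    using exp_lower_Taylor_quadratic[of "1 / 5 :: real"] by (simp add: power2_eq_square)
  then have "(122 / 100) ^ n \<le> exp (1 / 5 :: real) ^ n" by (intro power_mono) auto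
  also have "\<dots> = exp (real n / 5)" by (simp add: exp_of_nat_mult[symmetric])
  finally show ?thesis .
qed

text \<open>Euler's constant exceeds 19/33, and from \<open>N = 10\<close> on the correction
  \<open>1 / (2 * N)\<close> is at most 1/20, which still leaves 1/2.\<close>

lemma harm_ge_ln_plus_half:
  assumes "N \<ge> 10"
  shows "ln (real N + 1) + 1 / 2 \<le> (harm N :: real)"
proof -
  obtain n where n: "N = Suc n" using assms by (cases N) auto
  have "(euler_mascheroni :: real) \<le> harm N - ln (real N + 1) + 1 / (2 * real N)"
    using euler_mascheroni_upper[of n] by (simp add: n add_ac)
  moreover have "1 / (2 * real N) \<le> 1 / 20" using assms by (simp add: field_simps)
  ultimately show ?thesis using euler_mascheroni_gt_19_over_33 by linarith
qed

lemma sieve_mass_1_ge_sum: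
  assumes "finite A" "\<And>m. m \<in> A \<Longrightarrow> squarefree m \<and> m \<le> N"
  shows "(\<Sum>m\<in>A. 1 / real (totient m)) \<le> sieve_mass 1 N"
  unfolding sieve_mass_def by (intro sum_mono2) (use assms in \<open>auto simp: sieve_support_def\<close>)

lemma squarefree_prime_mult: "prime p \<Longrightarrow> prime q \<Longrightarrow> p \<noteq> q \<Longrightarrow> squarefree (p * q :: nat)"
  by (intro squarefree_mult_coprime primes_coprime squarefree_prime)

text \<open>The levels used while \<open>ln X\<close> is too small for the harmonic bound; the sets
  in the proof list all squarefree numbers up to the level.\<close>

lemma sieve_mass_values:
  "sieve_mass 1 1 \<ge> 1" "sieve_mass 1 2 \<ge> 2" "sieve_mass 1 3 \<ge> 5 / 2"
  "sieve_mass 1 6 \<ge> 13 / 4" "sieve_mass 1 10 \<ge> 11 / 3"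
proof -
  have pr: "prime (2::nat)" "prime (3::nat)" "prime (5::nat)" "prime (7::nat)" by simp_all
  have sq: "squarefree (1::nat)" "squarefree (2::nat)" "squarefree (3::nat)" "squarefree (5::nat)"
    "squarefree (6::nat)" "squarefree (7::nat)" "squarefree (10::nat)"
    using pr[THEN squarefree_prime] squarefree_prime_mult[of 2 3] squarefree_prime_mult[of 2 5] by simp_all
  have tot: "totient (2::nat) = 1" "totient 3 = 2" "totient 5 = 4" "totient 6 = 2" "totient 7 = 6" "totient 10 = 4"
    using pr[THEN totient_prime] totient_mult_coprime[of 2 3] totient_mult_coprime[of 2 5]
      primes_coprime[OF pr(1,2)] primes_coprime[OF pr(1,3)] by simp_all
  show "sieve_mass 1 1 \<ge> 1"
    by (rule order_trans[OF _ sieve_mass_1_ge_sum[of "{1}"]]) (use sq tot in auto)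
  show "sieve_mass 1 2 \<ge> 2"
    by (rule order_trans[OF _ sieve_mass_1_ge_sum[of "{1, 2}"]]) (use sq tot in auto)
  show "sieve_mass 1 3 \<ge> 5 / 2"
    by (rule order_trans[OF _ sieve_mass_1_ge_sum[of "{1, 2, 3}"]]) (use sq tot in auto)
  show "sieve_mass 1 6 \<ge> 13 / 4"
    by (rule order_trans[OF _ sieve_mass_1_ge_sum[of "{1, 2, 3, 5, 6}"]]) (use sq tot in auto)
  show "sieve_mass 1 10 \<ge> 11 / 3"
    by (rule order_trans[OF _ sieve_mass_1_ge_sum[of "{1, 2, 3, 5, 6, 7, 10}"]]) (use sq tot in auto)
qed

text \<open>As \<open>L exp (-L)\<close> decreases for \<open>L \<ge> 1\<close>, it suffices to check the numerical condition at the
  ends of the interval; \<open>e\<close> stands for \<open>N\<^sup>2 + N\<close>.\<close>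
lemma sieve_bound_on_interval:
  fixes L h :: real
  assumes L: "real a / 5 \<le> L" "L \<le> b" and a: "a \<ge> 5"
    and h: "0 < h" "h \<le> H"
    and num: "b / h + e * (real a / 5) / (122 / 100) ^ a < 3" and e: "e \<ge> 0"
  shows "1 / H + e / exp L < 3 / L"
proof -
  have L0: "L > 0" using L a by linarith
  have a1: "real a / 5 \<ge> 1" using a by simp
  \<comment> \<open>Holds because \<open>a / 5 \<ge> 1\<close>. With
    \<open>1 + t \<le> exp t\<close> it gives the monotonicity of \<open>L * exp (- L)\<close> in
    the form needed.\<close>
  have "L \<le> real a / 5 * (1 + (L - real a / 5))"
    using mult_nonneg_nonneg[of "real a / 5 - 1" "L - real a / 5"] L a1 by (simp add: algebra_simps)
  also have "\<dots> \<le> real a / 5 * exp (L - real a / 5)"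
    by (intro mult_left_mono exp_ge_add_one_self) auto
  also have "\<dots> = real a / 5 * (exp L / exp (real a / 5))" by (simp only: exp_diff)
  finally have "L / exp L \<le> real a / 5 / exp (real a / 5)" by (simp add: field_simps)
  also have "\<dots> \<le> real a / 5 / (122 / 100) ^ a"
    by (intro divide_left_mono exp_ge_power mult_pos_pos) auto
  finally have "e * (L / exp L) \<le> e * (real a / 5 / (122 / 100) ^ a)" using e by (rule mult_left_mono)
  moreover have "L / H \<le> b / h" using L L0 h by (intro frac_le) auto
  ultimately have "L / H + e * (L / exp L) < 3" using num by simp
  then have "L * (1 / H + e / exp L) < 3" by (simp add: algebra_simps)
  then show ?thesis using L0 by (simp add: field_simps)
qed

text \<open>Rounding \<open>z\<close> down costs nothing, since \<open>harm_ge_ln_plus_half\<close>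
  bounds the harmonic sum by \<open>ln (N + 1)\<close> and \<open>z < N + 1\<close>.\<close>

lemma sieve_bound_floor:
  fixes z :: real
  assumes "z \<ge> 10"
  shows "\<exists>N\<ge>1. real N \<le> z \<and> 1 / sieve_mass 1 N \<le> 1 / (ln z + 1 / 2)"
proof (intro exI conjI)
  let ?N = "nat \<lfloor>z\<rfloor>"
  show "?N \<ge> 1" "real ?N \<le> z" using assms by linarith+
  have "?N \<ge> 10" using assms by linarith
  moreover have "ln z \<le> ln (real ?N + 1)" using assms by (intro ln_mono) linarith+
  ultimately have "ln z + 1 / 2 \<le> sieve_mass 1 ?N"
    using harm_ge_ln_plus_half[of ?N] harm_le_sieve_mass_1[of ?N] by linarith
  moreover have "ln z > 0" using assms by simp
  ultimately show "1 / sieve_mass 1 ?N \<le> 1 / (ln z + 1 / 2)" by (intro divide_left_mono) auto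
qed

lemma exp_minus_le:
  assumes "x = real n / 5" "1 / (122 / 100) ^ n \<le> c"
  shows "exp (- x) \<le> c"
proof -
  have "exp (- x) = 1 / exp (real n / 5)" by (simp add: assms(1) exp_minus field_simps)
  also have "\<dots> \<le> 1 / (122 / 100) ^ n" by (intro divide_left_mono exp_ge_power) auto
  finally show ?thesis using assms(2) by linarith
qed

section \<open>Levels for small and for large \<open>ln X\<close>\<close>

lemma sieve_bound_small:
  fixes X :: real
  assumes X: "X > 1" and L16: "ln X \<le> 16"
  shows "\<exists>N\<ge>1. 1 / sieve_mass 1 N + (real N ^ 2 + real N) / X < 3 / ln X"
proof -
  define L where "L = ln X"
  have L0: "L > 0" and XL: "X = exp L" using X by (auto simp: L_def)
  note v = sieve_mass_values
  \<comment> \<open>The ends are multiples of 1/5, to suit \<open>exp_ge_power\<close>. The cut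
    ranges use the levels 1, 2, 3, 6 and 10 in turn; the last one uses a level growing with
    \<open>L\<close>.\<close>
  consider "L \<le> 1" | "1 \<le> L" "L \<le> 2" | "2 \<le> L" "L \<le> 12 / 5" | "12 / 5 \<le> L" "L \<le> 16 / 5"
    | "16 / 5 \<le> L" "L \<le> 22 / 5" | "22 / 5 \<le> L" "L \<le> 28 / 5" | "28 / 5 \<le> L" "L \<le> 34 / 5"
    | "34 / 5 \<le> L" "L \<le> 43 / 5" | "43 / 5 \<le> L" "L \<le> 47 / 5" | "47 / 5 \<le> L" "L \<le> 53 / 5"
    | "53 / 5 \<le> L" by linarith
  then have "\<exists>N\<ge>1. 1 / sieve_mass 1 N + (real N ^ 2 + real N) / exp L < 3 / L"
  proof cases
    case 1
    have "1 / sieve_mass 1 1 \<le> 1" using v(1) by simp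
    moreover have "2 / exp L < 2"
    proof -
      have "exp L > 1" using L0 by simp
      then show ?thesis by (simp add: divide_less_eq)
    qed
    moreover have "3 \<le> 3 / L" using L0 1 by (simp add: field_simps)
    ultimately show ?thesis by (intro exI[of _ 1]) (simp add: power_divide)
  next
    case 2
    then show ?thesis using sieve_bound_on_interval[of 5 L 2 1 "sieve_mass 1 1" 2] v
      by (intro exI[of _ 1]) (simp add: power_divide)
  next
    case 3
    then show ?thesis using sieve_bound_on_interval[of 10 L "12/5" 1 "sieve_mass 1 1" 2] v
      by (intro exI[of _ 1]) (simp add: power_divide)
  next
    case 4
    then show ?thesis using sieve_bound_on_interval[of 12 L "16/5" 2 "sieve_mass 1 2" 6] v
      by (intro exI[of _ 2]) (simp add: power_divide)
  next
    case 5
    then show ?thesis using sieve_bound_on_interval[of 16 L "22/5" 2 "sieve_mass 1 2" 6] v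
      by (intro exI[of _ 2]) (simp add: power_divide)
  next
    case 6
    then show ?thesis using sieve_bound_on_interval[of 22 L "28/5" "5/2" "sieve_mass 1 3" 12] v
      by (intro exI[of _ 3]) (simp add: power_divide)
  next
    case 7
    then show ?thesis using sieve_bound_on_interval[of 28 L "34/5" "5/2" "sieve_mass 1 3" 12] v
      by (intro exI[of _ 3]) (simp add: power_divide)
  next
    case 8
    then show ?thesis using sieve_bound_on_interval[of 34 L "43/5" "13/4" "sieve_mass 1 6" 42] v
      by (intro exI[of _ 6]) (simp add: power_divide)
  next
    case 9
    then show ?thesis using sieve_bound_on_interval[of 43 L "47/5" "13/4" "sieve_mass 1 6" 42] v
      by (intro exI[of _ 6]) (simp add: power_divide)
  next
    case 10
    then show ?thesis using sieve_bound_on_interval[of 47 L "53/5" "11/3" "sieve_mass 1 10" 110] v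
      by (intro exI[of _ 10]) (simp add: power_divide)
  next
    case 11
    \<comment> \<open>The shift 17/5 fixes the leading error at \<open>exp (- 17/5)\<close>, about
      0.033. The main term becomes \<open>2 / (L - 12/5)\<close>, as
      \<open>ln z + 1/2 = (L - 12/5) / 2\<close>.\<close>
    define z where "z = exp ((L - 17 / 5) / 2)"
    have lnz: "ln z = (L - 17 / 5) / 2" by (simp add: z_def)
    have "10 \<le> exp (real 18 / 5)" using exp_ge_power[of 18] by (rule order_trans[rotated]) (simp add: power_divide)
    also have "\<dots> \<le> z" using 11 by (simp add: z_def)
    finally obtain N where N: "N \<ge> 1" "real N \<le> z" "1 / sieve_mass 1 N \<le> 1 / (ln z + 1 / 2)"
      using sieve_bound_floor by blast
    have "real N ^ 2 + real N \<le> z ^ 2 + z" using N by (intro add_mono power_mono) auto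
    then have "(real N ^ 2 + real N) / exp L \<le> (z ^ 2 + z) / exp L" by (intro divide_right_mono) auto
    also have "\<dots> = exp (- (17 / 5)) + exp (- ((L + 17 / 5) / 2))"
      unfolding z_def add_divide_distrib exp_double[symmetric] exp_diff[symmetric] power2_eq_square exp_add[symmetric]
      by (simp add: field_simps)
    also have "exp (- (17 / 5)) \<le> (341 / 10000 :: real)"
      by (rule exp_minus_le[of _ 17]) (simp_all add: power_divide)
    also have "exp (- ((L + 17 / 5) / 2)) \<le> exp (- (real 35 / 5))" using 11 by simp
    also have "\<dots> \<le> 1 / 1000" by (rule exp_minus_le[of _ 35]) (simp_all add: power_divide)
    finally have 1: "(real N ^ 2 + real N) / exp L \<le> 352 / 10000" by linarith
    have "1 / sieve_mass 1 N \<le> 2 / (L - 12 / 5)" using N(3) by (simp add: lnz field_simps)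
    moreover have "2 / (L - 12 / 5) + 352 / 10000 < 3 / L"
    proof -
      \<comment> \<open>On the range between 53/5 and 16 this replaces \<open>L * L\<close> by its
        chord, so that the remaining inequality is linear in \<open>L\<close>.\<close>
      have "(L - 53 / 5) * (16 - L) \<ge> 0" using 11 L16 by (intro mult_nonneg_nonneg) (auto simp: L_def)
      moreover have "(L - 53 / 5) * (16 - L) = 133 / 5 * L - L * L - 848 / 5" by (simp add: field_simps)
      ultimately have "L * L \<le> 133 / 5 * L - 848 / 5" by simp
      then have "352 / 10000 * (L * L - 12 / 5 * L) \<le> 352 / 10000 * (121 / 5 * L - 848 / 5)"
        by (intro mult_left_mono) auto
      also have "\<dots> < L - 36 / 5" using 11 by simp
      finally have "352 / 10000 * (L * L - 12 / 5 * L) < L - 36 / 5" .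
      then have "352 / 10000 * (L * (L - 12 / 5)) < L - 36 / 5" by (simp add: right_diff_distrib mult.commute)
      then have "352 / 10000 < (L - 36 / 5) / (L * (L - 12 / 5))" using 11 by (simp add: field_simps)
      also have "\<dots> = 3 / L - 2 / (L - 12 / 5)" using 11 by (simp add: field_simps)
      finally show ?thesis by simp
    qed
    ultimately show ?thesis using N(1) 1 by (intro exI[of _ N]) linarith
  qed
  then show ?thesis by (simp add: XL)
qed

text \<open>The budget beyond \<open>2 / L\<close> is \<open>16 / L^2\<close>. With
  \<open>ln z = (L - 5) / 2\<close> the main term is at most \<open>2 / (L - 4)\<close>, which uses
  \<open>(32/3) / L^2\<close> of it. The squared weight sum uses \<open>3.8 / L^2\<close>, by
  \<open>L - 5 \<ge> 11/16 * L\<close> and \<open>exp (- 5) \<le> 0.00694\<close>, and the primes up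
  to \<open>N\<close> use \<open>1 / L^2\<close>.\<close>

lemma sieve_bound_large:
  fixes X :: real
  assumes X: "X > 1" and L16: "ln X \<ge> 16"
  shows "\<exists>N\<ge>1. \<exists>z>1. real N \<le> z \<and>
    1 / sieve_mass 1 N + ((8 * z / ln z)\<^sup>2 + real N) / X < 2 / ln X * (1 + 8 / ln X)"
proof -
  define L where "L = ln X"
  have L: "L \<ge> 16" and XL: "X = exp L" using X L16 by (auto simp: L_def)
  define z where "z = exp ((L - 5) / 2)"
  have lnz: "ln z = (L - 5) / 2" by (simp add: z_def)
  have "10 \<le> exp (real 18 / 5)" using exp_ge_power[of 18] by (rule order_trans[rotated]) (simp add: power_divide)
  also have "\<dots> \<le> z" using L by (simp add: z_def)
  finally have z10: "z \<ge> 10" .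
  then obtain N where N: "N \<ge> 1" "real N \<le> z" "1 / sieve_mass 1 N \<le> 1 / (ln z + 1 / 2)"
    using sieve_bound_floor by blast
  have "((8 * z / ln z)\<^sup>2 + real N) / exp L \<le> ((8 * z / ln z)\<^sup>2 + z) / exp L"
    using N by (intro divide_right_mono) auto
  also have "\<dots> = 64 / (ln z)\<^sup>2 * (z\<^sup>2 / exp L) + z / exp L"
    by (simp add: power_divide power_mult_distrib add_divide_distrib)
  also have "z\<^sup>2 / exp L = exp (- 5)"
    unfolding z_def exp_double[symmetric] exp_diff[symmetric] by (simp add: field_simps)
  also have "z / exp L = exp (- ((L + 5) / 2))"
    unfolding z_def exp_diff[symmetric] by (simp add: field_simps)
  also have "64 / (ln z)\<^sup>2 * exp (- 5) \<le> 64 / (ln z)\<^sup>2 * (694 / 100000)"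
    by (intro mult_left_mono exp_minus_le[of _ 25]) (simp_all add: power_divide)
  also have "64 / (ln z)\<^sup>2 * (694 / 100000) \<le> (38 / 10) / L\<^sup>2"
  proof -
    have "11 * L \<le> 16 * (L - 5)" using L by simp
    then have "(11 * L)\<^sup>2 \<le> (16 * (L - 5))\<^sup>2" using L by (intro power_mono) auto
    then have "121 * L\<^sup>2 \<le> 256 * (L - 5)\<^sup>2" by (simp only: power_mult_distrib) simp
    then have "(L - 5)\<^sup>2 \<ge> 121 / 256 * L\<^sup>2" by simp
    moreover have "64 / (ln z)\<^sup>2 = 256 / (L - 5)\<^sup>2" by (simp add: lnz power_divide)
    moreover have "256 / (L - 5)\<^sup>2 \<le> 256 / (121 / 256 * L\<^sup>2)"
      using calculation L by (intro divide_left_mono mult_pos_pos) auto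
    ultimately have "64 / (ln z)\<^sup>2 * (694 / 100000) \<le> 256 / (121 / 256 * L\<^sup>2) * (694 / 100000)"
      by (intro mult_right_mono) auto
    also have "\<dots> \<le> (38 / 10) / L\<^sup>2" using L by (simp add: field_simps)
    finally show ?thesis .
  qed
  also have "exp (- ((L + 5) / 2)) \<le> 1 / L\<^sup>2"
  proof -
    have "L\<^sup>2 / 8 \<le> exp (L / 2)"
      using exp_lower_Taylor_quadratic[of "L / 2"] L by (simp add: power2_eq_square)
    moreover have "8 \<le> exp (5 / 2 :: real)"
    proof -
      have "8 \<le> exp (real 12 / 5)" using exp_ge_power[of 12] by (rule order_trans[rotated]) (simp add: power_divide)
      also have "\<dots> \<le> exp (5 / 2)" by simp
      finally show ?thesis .
    qed
    ultimately have "L\<^sup>2 / 8 * 8 \<le> exp (L / 2) * exp (5 / 2)" by (intro mult_mono) auto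
    also have "\<dots> = exp ((L + 5) / 2)" by (simp add: exp_add[symmetric] add_divide_distrib)
    finally show ?thesis using L by (simp add: exp_minus field_simps)
  qed
  finally have 1: "((8 * z / ln z)\<^sup>2 + real N) / exp L \<le> (48 / 10) / L\<^sup>2" by simp
  have "1 / sieve_mass 1 N \<le> 2 / (L - 4)" using N(3) by (simp add: lnz field_simps)
  also have "\<dots> \<le> 2 / L + (32 / 3) / L\<^sup>2"
  proof -
    have "2 / (L - 4) = 2 / L + 8 / (L * (L - 4))" using L by (simp add: field_simps)
    moreover have "8 / (L * (L - 4)) \<le> 8 / (3 / 4 * L\<^sup>2)"
      using L by (intro divide_left_mono mult_pos_pos) (auto simp: power2_eq_square)
    ultimately show ?thesis by simp
  qed
  finally have 2: "1 / sieve_mass 1 N \<le> 2 / L + (32 / 3) / L\<^sup>2" .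
  have "(32 / 3) / L\<^sup>2 + (48 / 10) / L\<^sup>2 < 16 / L\<^sup>2" using L by (simp add: field_simps)
  then have "1 / sieve_mass 1 N + ((8 * z / ln z)\<^sup>2 + real N) / exp L < 2 / L + 16 / L\<^sup>2"
    using 1 2 by linarith
  also have "\<dots> = 2 / L * (1 + 8 / L)" by (simp add: power2_eq_square algebra_simps)
  finally have "1 / sieve_mass 1 N + ((8 * z / ln z)\<^sup>2 + real N) / X < 2 / ln X * (1 + 8 / ln X)"
    unfolding XL by simp
  moreover have "z > 1" using z10 by simp
  ultimately show ?thesis using N(1,2) by blast
qed

theorem theorem4p2:
  fixes x y :: real and l k :: nat and f :: "real \<Rightarrow> real"
  assumes "x \<ge> 0" and "y > 0"
    and "k \<ge> 1" and "coprime l k"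
    and "W11 {x..x+y} f"
    and "\<forall>t\<in>{x..x+y}. f t \<ge> 0"
    and "rho {x..x+y} f > real k"
  shows "(\<Sum>p\<in>{p::nat. prime p \<and> real p \<in> {x..x+y} \<and> [p = l] (mod k)}. f (real p))
           < 2 * norm1 {x..x+y} f / (real (totient k) * ln (rho {x..x+y} f / real k))
             * (1 + 8 / ln (rho {x..x+y} f / real k))
         \<and> (\<Sum>p\<in>{p::nat. prime p \<and> real p \<in> {x..x+y} \<and> [p = l] (mod k)}. f (real p))
           < 3 * norm1 {x..x+y} f / (real (totient k) * ln (rho {x..x+y} f / real k))"
proof -
  let ?I = "{x..x+y}"
  define T where "T = (\<Sum>p | prime p \<and> real p \<in> ?I \<and> [p = l] (mod k). f (real p))"
  define M where "M = norm_inf ?I f + deriv_norm1 ?I f"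
  define X where "X = rho ?I f / real k"
  define L where "L = ln X"
  define U where "U = norm1 ?I f / real (totient k)"
  have k0: "real k > 0" and tk0: "real (totient k) > 0" using assms(3) by auto
  have X1: "X > 1" using assms(7) k0 by (simp add: X_def)
  then have L0: "L > 0" by (simp add: L_def)
  \<comment> \<open>A value above \<open>k\<close> excludes the default 0 of \<open>rho\<close>, so
    the quotient formula applies.\<close>
  have rho: "rho ?I f = norm1 ?I f / M" "rho ?I f > 0"
    using assms(7) k0 by (auto simp: rho_def M_def split: if_splits)
  have "norm1 ?I f \<ge> 0" unfolding norm1_def
    using assms(5) by (intro integral_nonneg integrable_continuous_real continuous_intros) (auto simp: W11_def)
  then have M0: "M > 0" using rho by (auto simp: zero_less_divide_iff)
  have norm: "norm1 ?I f = real k * X * M" using rho M0 k0 by (simp add: X_def)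
  have U0: "U > 0" using norm k0 X1 M0 tk0 by (simp add: U_def)
  \<comment> \<open>Exactly, \<open>M\<close> is \<open>totient k / k\<close> times
    \<open>U / X\<close>; the factor is at most 1 and is dropped from the error term.\<close>
  have MU: "M \<le> U / X"
  proof -
    have "real (totient k) * M \<le> real k * M" using M0 totient_le[of k] by (intro mult_right_mono) auto
    then show ?thesis using X1 tk0 by (simp add: U_def norm field_simps)
  qed
  have bound: "T \<le> U * (1 / sieve_mass 1 N + (w\<^sup>2 + real N) / X)"
    if N: "N \<ge> 1" and w: "(\<Sum>d\<in>sieve_support k N. \<bar>selberg_weight k N d\<bar>) \<le> w" for N w
  proof -
    let ?w = "\<Sum>d\<in>sieve_support k N. \<bar>selberg_weight k N d\<bar>"
    have "T \<le> norm1 ?I f / (real k * sieve_mass k N) + M * (?w\<^sup>2 + real N)"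
      unfolding T_def M_def by (rule prime_sum_sieve_bound[OF assms(1-6) N])
    also have "norm1 ?I f / (real k * sieve_mass k N) \<le> U / sieve_mass 1 N"
    proof -
      have "real (totient k) * sieve_mass 1 N \<le> real k * sieve_mass k N"
        using sieve_mass_1_le[OF assms(3), of N] tk0 by (simp add: field_simps)
      then have "norm1 ?I f / (real k * sieve_mass k N) \<le> norm1 ?I f / (real (totient k) * sieve_mass 1 N)"
        using k0 tk0 sieve_mass_pos[OF N] \<open>norm1 ?I f \<ge> 0\<close>
        by (intro divide_left_mono mult_pos_pos) auto
      then show ?thesis by (simp add: U_def)
    qed
    also have "M * (?w\<^sup>2 + real N) \<le> U / X * (w\<^sup>2 + real N)"
      using MU w M0 by (intro mult_mono add_mono power_mono) (auto intro: sum_nonneg)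
    finally show ?thesis by (simp add: algebra_simps add_divide_distrib)
  qed
  have "T < U * (2 / L * (1 + 8 / L)) \<and> T < U * (3 / L)"
  \<comment> \<open>\<open>2 / L * (1 + 8 / L)\<close> equals \<open>3 / L\<close> at
    \<open>L = 16\<close>, so on each side the stronger inequality is proved and implies the
    other.\<close>
  proof (cases "L \<le> 16")
    case True
    obtain N where N: "N \<ge> 1" "1 / sieve_mass 1 N + ((real N)\<^sup>2 + real N) / X < 3 / L"
      using sieve_bound_small[OF X1] True by (auto simp: L_def)
    have "T \<le> U * (1 / sieve_mass 1 N + ((real N)\<^sup>2 + real N) / X)"
      by (rule bound[OF N(1) sum_abs_selberg_weight_le_card[OF N(1)]])
    also have "\<dots> < U * (3 / L)" using N(2) U0 by (rule mult_strict_left_mono)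
    finally have 1: "T < U * (3 / L)" .
    have "2 / L * (1 + 8 / L) \<ge> 3 / L" using L0 True by (simp add: field_simps)
    then have "U * (3 / L) \<le> U * (2 / L * (1 + 8 / L))" using U0 by (intro mult_left_mono) auto
    with 1 show ?thesis by linarith
  next
    case False
    obtain N z where N: "N \<ge> 1" "z > 1" "real N \<le> z"
        "1 / sieve_mass 1 N + ((8 * z / ln z)\<^sup>2 + real N) / X < 2 / L * (1 + 8 / L)"
      using sieve_bound_large[OF X1] False by (auto simp: L_def)
    have "T \<le> U * (1 / sieve_mass 1 N + ((8 * z / ln z)\<^sup>2 + real N) / X)"
      by (rule bound[OF N(1) sum_abs_selberg_weight_le[OF N(1,3,2)]])
    also have "\<dots> < U * (2 / L * (1 + 8 / L))" using N(4) U0 by (rule mult_strict_left_mono)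
    finally have 1: "T < U * (2 / L * (1 + 8 / L))" .
    have "2 / L * (1 + 8 / L) \<le> 3 / L" using L0 False by (simp add: field_simps)
    then have "U * (2 / L * (1 + 8 / L)) \<le> U * (3 / L)" using U0 by (intro mult_left_mono) auto
    with 1 show ?thesis by linarith
  qed
  moreover have "2 * norm1 ?I f / (real (totient k) * L) * (1 + 8 / L) = U * (2 / L * (1 + 8 / L))"
    "3 * norm1 ?I f / (real (totient k) * L) = U * (3 / L)"
    by (simp_all add: U_def)
  ultimately show ?thesis
    unfolding T_def[symmetric] X_def[symmetric] L_def[symmetric] by (simp only:)
qed

end
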